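(* Let $\{x_t\}_{t\ge 0}$ be a Markov chain on a finite or countably infinite state space $S$ with transition probability matrix $P=(p_{ij})$, let $r_t=r(x_t,x_{t+1})$ be the scalar reward of the transition from $x_t$ to $x_{t+1}$, let $\phi=(\phi_1,\dots,\phi_n)^T:S\to\mathbb{R}^n$ be a fixed vector of basis functions, let $0<\gamma\le 1$ be a discount factor, and let $0\le\lambda\le 1$. Let $\{W_t\}$ be the weight vectors generated along the trajectory $\{x_t\}$ by the RLS-TD($\lambda$) algorithm defined in the context, with initial variance matrix $P_0=\delta I$, $\delta>0$. Assume: 1. The Markov chain $\{x_t\}$ is ergodic, and there is a unique distribution $\pi$ that satisfies $\pi^TP=\pi^T$, with $\pi(i)>0$ for all $i\in S$ ($\pi$ is a finite or infinite vector, depending on the cardinality of $S$). 2. The transition rewards satisfy $E_0[r^2(x_t,x_{t+1})]<\infty$. 3. The matrix $\Phi=[\phi_1,\phi_2,\dots,\phi_n]\in\mathbb{R}^{N\times n}$ (rows indexed by the states, $N$ the possibly infinite cardinality of $S$) has full column rank, that is, the basis functions $\phi_1,\dots,\phi_n$ are linearly independent. 4. For every $i=1,\dots,n$, $E_0[\phi_i^2(x_t)]<\infty$. 5. The matrix $P_0^{-1}+\frac1T\sum_{t=1}^{T}A(X_t)$ is non-singular for all $T>0$, where $A(X_t)=\vec z_t\,(\phi^T(x_t)-\gamma\phi^T(x_{t+1}))$ and $\vec z_t$ is the eligibility trace vector of the algorithm. Then the asymptotic estimate found by RLS-TD($\lambda$) converges with probability 1 to $W^*$, i.e. $\lim_{t\to\infty}W_t=W^*$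 with probability 1, where $W^*\in\mathbb{R}^n$ is the vector determined by $$E_0[A(X_t)]\,W^*-E_0[b(X_t)]=0,\qquad b(X_t)=\vec z_t\,r_t .$$
   Context: RLS-TD($\lambda$) algorithm. Let $0<\mu\le 1$ be the forgetting factor ($\mu=1$ is the standard RLS-TD($\lambda$) algorithm; $0<\mu\le1$ is the general forgetting-factor case). The eligibility trace vectors are $\vec z_t=\gamma\lambda\,\vec z_{t-1}+\phi(x_t)$ for $t\ge0$, with $\vec z_{-1}=0$. Starting from an initial weight vector $W_0\in\mathbb{R}^n$, an initial state $x_0$ and the variance matrix $P_0=\delta I\in\mathbb{R}^{n\times n}$, where $\delta$ is a positive number and $I$ the identity matrix, for $t=0,1,2,\dots$ one observes the transition from $x_t$ to $x_{t+1}$ and the reward $r_t=r(x_t,x_{t+1})$ and sets $$K_{t+1}=P_t\vec z_t\big/\bigl(\mu+(\phi^T(x_t)-\gamma\phi^T(x_{t+1}))P_t\vec z_t\bigr),$$ $$W_{t+1}=W_t+K_{t+1}\bigl(r_t-(\phi^T(x_t)-\gamma\phi^T(x_{t+1}))W_t\bigr),$$ $$P_{t+1}=\frac1\mu\Bigl[P_t-P_t\vec z_t\bigl[\mu+(\phi^T(x_t)-\gamma\phi^T(x_{t+1}))P_t\vec z_t\bigr]^{-1}(\phi^T(x_t)-\gamma\phi^T(x_{t+1}))P_t\Bigr].$$ (The variance matrices $P_t$ are not to be confused with the transition matrix $P$.) Expectation $E_0$. In assumptions 2 and 4, $E_0[\cdot]$ is the expectation with respect to the distribution $\pi$, i.e.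 for the chain in steady state, with $\Pr\{x_t=i\}=\pi(i)$ for all $i$ and $t$. In the equation determining $W^*$, $E_0[\cdot]$ is the expectation with respect to the unique invariant distribution of the Markov process $X_t=(x_t,x_{t+1},\vec z_t)$; the corresponding stationary process is obtained by taking the chain in steady state and putting $\vec z_t=\sum_{\tau=-\infty}^{t}(\gamma\lambda)^{t-\tau}\phi(x_\tau)$.
   Formalization: Proved for forgetting factor μ=1 (for μ<1 the weights generally keep fluctuating, so the claim fails); for γ=1 it is assumed that the equation determines a unique W* (it can be singular, e.g. φ constant); the update denominators are assumed nonzero. *)

theory Defs
  imports "HOL-Probability.Probability"
begin

text \<open>A transition matrix on a countable type is a kernel \<open>K :: 's \<Rightarrow> 's pmf\<close>, its entries being
  \<open>pmf (K i) j\<close>.\<close>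

definition markov_chain :: "'w measure \<Rightarrow> ('s::countable \<Rightarrow> 's pmf) \<Rightarrow> (nat \<Rightarrow> 'w \<Rightarrow> 's) \<Rightarrow> bool" where
  "markov_chain M K x \<longleftrightarrow>
     prob_space M \<and>
     (\<forall>t. x t \<in> M \<rightarrow>\<^sub>M count_space UNIV) \<and>
     (\<forall>t s. \<P>(\<omega> in M. \<forall>i\<le>t. x i \<omega> = s i) \<noteq> 0 \<longrightarrow>
        \<P>(\<omega> in M. x (Suc t) \<omega> = s (Suc t) \<bar> \<forall>i\<le>t. x i \<omega> = s i) = pmf (K (s t)) (s (Suc t)))"

primrec nstep :: "('s \<Rightarrow> 's pmf) \<Rightarrow> nat \<Rightarrow> 's \<Rightarrow> 's pmf" where
  "nstep K 0 i = return_pmf i"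
| "nstep K (Suc m) i = bind_pmf (nstep K m i) K"

definition irreducible_chain :: "('s \<Rightarrow> 's pmf) \<Rightarrow> bool" where
  "irreducible_chain K \<longleftrightarrow> (\<forall>i j. \<exists>m. pmf (nstep K m i) j > 0)"

definition aperiodic_chain :: "('s \<Rightarrow> 's pmf) \<Rightarrow> bool" where
  "aperiodic_chain K \<longleftrightarrow> (\<forall>i. Gcd {m. m > 0 \<and> pmf (nstep K m i) i > 0} = 1)"

text \<open>Positive recurrence, the third ingredient of ergodicity, is equivalent for an irreducible
  chain to the existence of a stationary distribution.\<close>

definition stationary :: "('s \<Rightarrow> 's pmf) \<Rightarrow> 's pmf \<Rightarrow> bool" where
  "stationary K \<pi> \<longleftrightarrow> bind_pmf \<pi> K = \<pi>"

definition ergodic_chain :: "('s \<Rightarrow> 's pmf) \<Rightarrow> bool" where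
  "ergodic_chain K \<longleftrightarrow> irreducible_chain K \<and> aperiodic_chain K \<and> (\<exists>\<pi>. stationary K \<pi>)"

text \<open>The law of \<open>(x\<^sub>t, x\<^sub>t\<^sub>+\<^sub>1)\<close> when \<open>x\<^sub>t\<close> has law \<open>\<pi>\<close>.\<close>

definition transition_law :: "('s \<Rightarrow> 's pmf) \<Rightarrow> 's pmf \<Rightarrow> ('s \<times> 's) pmf" where
  "transition_law K \<pi> = bind_pmf \<pi> (\<lambda>i. map_pmf (Pair i) (K i))"

definition outer :: "real ^ 'n \<Rightarrow> real ^ 'n \<Rightarrow> real ^ 'n ^ 'n" where
  "outer u v = (\<chi> i j. u $ i * v $ j)"

primrec trace_vec :: "real \<Rightarrow> real \<Rightarrow> ('s \<Rightarrow> real ^ 'n) \<Rightarrow> (nat \<Rightarrow> 's) \<Rightarrow> nat \<Rightarrow> real ^ 'n" where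
  "trace_vec \<gamma> lam \<phi> x 0 = \<phi> (x 0)"
| "trace_vec \<gamma> lam \<phi> x (Suc t) = (\<gamma> * lam) *\<^sub>R trace_vec \<gamma> lam \<phi> x t + \<phi> (x (Suc t))"

definition feature_diff :: "real \<Rightarrow> ('s \<Rightarrow> real ^ 'n) \<Rightarrow> 's \<Rightarrow> 's \<Rightarrow> real ^ 'n" where
  "feature_diff \<gamma> \<phi> i j = \<phi> i - \<gamma> *\<^sub>R \<phi> j"

definition td_A :: "real \<Rightarrow> ('s \<Rightarrow> real ^ 'n) \<Rightarrow> 's \<times> 's \<times> (real ^ 'n) \<Rightarrow> real ^ 'n ^ 'n" where
  "td_A \<gamma> \<phi> = (\<lambda>(i, j, z). outer z (feature_diff \<gamma> \<phi> i j))"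

definition td_b :: "('s \<Rightarrow> 's \<Rightarrow> real) \<Rightarrow> 's \<times> 's \<times> (real ^ 'n) \<Rightarrow> real ^ 'n" where
  "td_b r = (\<lambda>(i, j, z). r i j *\<^sub>R z)"

definition td_state :: "real \<Rightarrow> real \<Rightarrow> ('s \<Rightarrow> real ^ 'n) \<Rightarrow> (nat \<Rightarrow> 's) \<Rightarrow> nat \<Rightarrow> 's \<times> 's \<times> (real ^ 'n)" where
  "td_state \<gamma> lam \<phi> x t = (x t, x (Suc t), trace_vec \<gamma> lam \<phi> x t)"

text \<open>A run of the algorithm with forgetting factor \<open>\<mu>\<close> along the trajectory \<open>x\<close>, with variance
  matrices \<open>V t\<close> and weights \<open>W t\<close>. A step needs the scalar \<open>q\<close> to be invertible; the total
  division of HOL would otherwise turn an undefined step into a skipped one.\<close>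

definition rls_td_run ::
  "real \<Rightarrow> real \<Rightarrow> real \<Rightarrow> ('s \<Rightarrow> real ^ 'n) \<Rightarrow> ('s \<Rightarrow> 's \<Rightarrow> real) \<Rightarrow> real \<Rightarrow> real ^ 'n \<Rightarrow>
   (nat \<Rightarrow> 's) \<Rightarrow> (nat \<Rightarrow> real ^ 'n ^ 'n) \<Rightarrow> (nat \<Rightarrow> real ^ 'n) \<Rightarrow> bool" where
  "rls_td_run \<mu> \<gamma> lam \<phi> r \<delta> w0 x V W \<longleftrightarrow>
     V 0 = \<delta> *\<^sub>R mat 1 \<and> W 0 = w0 \<and>
     (\<forall>t. let z = trace_vec \<gamma> lam \<phi> x t;
              d = feature_diff \<gamma> \<phi> (x t) (x (Suc t));
              q = \<mu> + d \<bullet> (V t *v z);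
              k = (1 / q) *\<^sub>R (V t *v z)
          in q \<noteq> 0 \<and>
             W (Suc t) = W t + (r (x t) (x (Suc t)) - d \<bullet> W t) *\<^sub>R k \<and>
             V (Suc t) = (1 / \<mu>) *\<^sub>R (V t - (1 / q) *\<^sub>R outer (V t *v z) (d v* V t)))"

text \<open>Invariance of a law \<open>\<nu>\<close> for \<open>X\<^sub>t = (x\<^sub>t, x\<^sub>t\<^sub>+\<^sub>1, z\<^sub>t)\<close>, which moves from \<open>(i, j, z)\<close> to
  \<open>(j, k, \<gamma> lam z + \<phi> j)\<close> with \<open>k\<close> drawn from \<open>K j\<close>.\<close>

definition td_invariant ::
  "('s::countable \<Rightarrow> 's pmf) \<Rightarrow> real \<Rightarrow> real \<Rightarrow> ('s \<Rightarrow> real ^ 'n) \<Rightarrow> ('s \<times> 's \<times> (real ^ 'n)) measure \<Rightarrow> bool" where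
  "td_invariant K \<gamma> lam \<phi> \<nu> \<longleftrightarrow>
     prob_space \<nu> \<and>
     sets \<nu> = sets (count_space UNIV \<Otimes>\<^sub>M count_space UNIV \<Otimes>\<^sub>M borel) \<and>
     (\<forall>B\<in>sets \<nu>. emeasure \<nu> B =
        (\<integral>\<^sup>+ (i, j, z). emeasure (measure_pmf (K j)) {k. (j, k, (\<gamma> * lam) *\<^sub>R z + \<phi> j) \<in> B} \<partial>\<nu>))"

text \<open>The equation \<open>E\<^sub>0[A(X\<^sub>t)] w - E\<^sub>0[b(X\<^sub>t)] = 0\<close>, with \<open>E\<^sub>0\<close> the expectation under \<open>\<nu>\<close>.\<close>

definition td_equation ::
  "real \<Rightarrow> ('s \<Rightarrow> real ^ 'n) \<Rightarrow> ('s \<Rightarrow> 's \<Rightarrow> real) \<Rightarrow> ('s \<times> 's \<times> (real ^ 'n)) measure \<Rightarrow> real ^ 'n \<Rightarrow> bool" where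
  "td_equation \<gamma> \<phi> r \<nu> w \<longleftrightarrow> (LINT X|\<nu>. td_A \<gamma> \<phi> X) *v w - (LINT X|\<nu>. td_b r X) = 0"

end

theory Submission
  imports Defs
begin

text \<open>By the Sherman-Morrison formula, \<open>V t\<close> is the inverse of
  \<open>R t = I / \<delta> + (\<Sum>s<t. A(X\<^sub>s))\<close>, and the weights solve \<open>R t W t = w0 / \<delta> + (\<Sum>s<t. b(X\<^sub>s))\<close>. So
  everything reduces to a strong law for \<open>A(X\<^sub>t)\<close> and \<open>b(X\<^sub>t)\<close> and to the invertibility of \<open>E\<^sub>0[A]\<close>.

  If \<open>\<gamma> lam = 1\<close>, translating \<open>z\<close> maps invariant laws to invariant laws, which contradicts uniqueness;
  hence \<open>\<beta> = \<gamma> lam < 1\<close>. Then \<open>z\<close> is square integrable under \<open>\<nu>\<close>, and for \<open>\<gamma> < 1\<close> stationarity of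
  \<open>z\<^sub>t\<^sub>+\<^sub>1 = \<beta> z\<^sub>t + \<phi>(x\<^sub>t\<^sub>+\<^sub>1)\<close> makes \<open>E\<^sub>0[A]\<close> positive definite.

  The strong law is Birkhoff's theorem for the process \<open>X\<^sub>t\<close> started in \<open>\<nu>\<close>. Ergodicity is replaced by
  the uniqueness of \<open>\<nu>\<close>: an invariant event has a harmonic probability \<open>h\<close>, and the tilted law
  \<open>h \<nu> / E[h]\<close> is again invariant, hence \<open>\<nu>\<close> itself. The law of the given chain is absolutely
  continuous with respect to that of the stationary one, and the different initial trace
  contributes only a term of order \<open>\<beta> ^ t\<close>.\<close>

section \<open>The normal equation of recursive least squares\<close>

lemma outer_mult_vec: "outer u v *v w = (v \<bullet> w) *\<^sub>R u"
  by (simp add: vec_eq_iff outer_def matrix_vector_mult_def inner_vec_def sum_distrib_left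
      sum_distrib_right ac_simps)

lemma matrix_mult_outer: "A ** outer u v = outer (A *v u) v"
  by (simp add: vec_eq_iff outer_def matrix_matrix_mult_def matrix_vector_mult_def
      sum_distrib_left sum_distrib_right ac_simps)

lemma outer_mult_matrix: "outer u v ** A = outer u (v v* A)"
  by (simp add: vec_eq_iff outer_def matrix_matrix_mult_def vector_matrix_mult_def
      sum_distrib_left ac_simps)

lemma outer_scaleR_left: "outer (c *\<^sub>R u) v = c *\<^sub>R outer u v"
  by (simp add: vec_eq_iff outer_def)

lemma matrix_mult_add_left: "(A + B) ** (C :: real ^ 'n ^ 'm) = A ** C + B ** C"
  by (simp add: vec_eq_iff matrix_matrix_mult_def distrib_right sum.distrib)

lemma matrix_mult_diff_right: "(A :: real ^ 'n ^ 'm) ** (B - C) = A ** B - A ** C"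
  by (simp add: vec_eq_iff matrix_matrix_mult_def right_diff_distrib sum_subtractf)

text \<open>Times \<open>R\<close> the correction \<open>outer (V *v z) (d v* V)\<close> gives
  \<open>outer z (d v* V)\<close>, and times \<open>outer z d\<close> it gives q - 1 copies of that,
  as q - 1 is the inner product of \<open>d\<close> with \<open>V *v z\<close>. Of the q copies the
  factor 1 / q leaves one, which cancels \<open>outer z d ** V\<close>.\<close>

lemma sherman_morrison:
  fixes V R :: "real ^ 'n ^ 'n"
  assumes inv: "R ** V = mat 1" and q: "q = 1 + d \<bullet> (V *v z)" "q \<noteq> 0"
  shows "(R + outer z d) ** (V - (1 / q) *\<^sub>R outer (V *v z) (d v* V)) = mat 1"
proof -
  have "R ** outer (V *v z) (d v* V) = outer z (d v* V)"
    using inv by (simp add: matrix_mult_outer matrix_vector_mul_assoc)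
  moreover have "outer z d ** outer (V *v z) (d v* V) = (q - 1) *\<^sub>R outer z (d v* V)"
    using q by (simp add: matrix_mult_outer outer_mult_vec outer_scaleR_left)
  ultimately have "(R + outer z d) ** (V - (1 / q) *\<^sub>R outer (V *v z) (d v* V))
      = mat 1 + outer z (d v* V) - (1 / q) *\<^sub>R (outer z (d v* V) + (q - 1) *\<^sub>R outer z (d v* V))"
    using inv
    by (simp add: matrix_mult_diff_right matrix_mult_add_left matrix_scalar_ac outer_mult_matrix
        flip: scalar_matrix_assoc)
  also have "(1 / q) *\<^sub>R (outer z (d v* V) + (q - 1) *\<^sub>R outer z (d v* V)) = outer z (d v* V)"
    using q(2) by (simp add: vec_eq_iff field_simps)
  finally show ?thesis by simp
qed

text \<open>The gain k solves \<open>R (Suc t) *v k = z t\<close>. Hence the weight update adds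
  \<open>(r - d \<bullet> W) z\<close> to the left side, while passing from \<open>R t\<close> to
  \<open>R (Suc t)\<close> adds \<open>(d \<bullet> W) z\<close>. The terms in \<open>W t\<close>
  cancel and only the new summand \<open>r z\<close> of the right side remains.\<close>

lemma rls_td_normal_equation:
  fixes \<phi> :: "'s \<Rightarrow> real ^ 'n"
  assumes run: "rls_td_run 1 \<gamma> lam \<phi> r \<delta> w0 x V W" and "\<delta> \<noteq> 0"
  defines "R \<equiv> \<lambda>t. (1 / \<delta>) *\<^sub>R mat 1 + (\<Sum>s<t. td_A \<gamma> \<phi> (td_state \<gamma> lam \<phi> x s))"
  shows "R t *v W t = (1 / \<delta>) *\<^sub>R w0 + (\<Sum>s<t. td_b r (td_state \<gamma> lam \<phi> x s))"
proof -
  define z d q where "z t = trace_vec \<gamma> lam \<phi> x t" and "d t = feature_diff \<gamma> \<phi> (x t) (x (Suc t))"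
    and "q t = 1 + d t \<bullet> (V t *v z t)" for t
  have V0: "V 0 = \<delta> *\<^sub>R mat 1" and W0: "W 0 = w0"
    and q: "q t \<noteq> 0"
    and WS: "W (Suc t) = W t + (r (x t) (x (Suc t)) - d t \<bullet> W t) *\<^sub>R ((1 / q t) *\<^sub>R (V t *v z t))"
    and VS: "V (Suc t) = V t - (1 / q t) *\<^sub>R outer (V t *v z t) (d t v* V t)" for t
    using run by (auto simp: rls_td_run_def Let_def z_def d_def q_def)
  have RS: "R (Suc t) = R t + outer (z t) (d t)" for t
    by (simp add: R_def td_A_def td_state_def z_def d_def)
  \<comment> \<open>A run guarantees \<open>q t \<noteq> 0\<close>, so the rank-one update of the
    inverse applies at every step.\<close>
  have RV: "R t ** V t = mat 1" for t
  proof (induction t)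
    case 0
    show ?case using \<open>\<delta> \<noteq> 0\<close>
      by (simp add: R_def V0 matrix_scalar_ac flip: scalar_matrix_assoc)
  next
    case (Suc t)
    then show ?case unfolding RS VS by (intro sherman_morrison[OF _ q_def q])
  qed
  show ?thesis
  proof (induction t)
    case 0
    show ?case by (simp add: R_def W0 flip: scaleR_matrix_vector_assoc)
  next
    case (Suc t)
    have "R t *v (V t *v z t) = z t"
      by (simp add: matrix_vector_mul_assoc RV)
    then have "R (Suc t) *v (V t *v z t) = q t *\<^sub>R z t"
      by (simp add: RS matrix_vector_mult_add_rdistrib outer_mult_vec q_def scaleR_add_left)
    then have "R (Suc t) *v ((1 / q t) *\<^sub>R (V t *v z t)) = z t"
      using q by (simp add: matrix_vector_mult_scaleR)
    then have "R (Suc t) *v W (Suc t)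
        = R t *v W t + (d t \<bullet> W t) *\<^sub>R z t + (r (x t) (x (Suc t)) - d t \<bullet> W t) *\<^sub>R z t"
      unfolding WS matrix_vector_right_distrib matrix_vector_mult_scaleR
      by (simp add: RS matrix_vector_mult_add_rdistrib outer_mult_vec)
    also have "\<dots> = R t *v W t + r (x t) (x (Suc t)) *\<^sub>R z t"
      by (simp add: algebra_simps)
    finally show ?case
      by (simp add: Suc.IH td_b_def td_state_def z_def)
  qed
qed

section \<open>Limits of solutions of linear systems\<close>

lemma tendsto_det:
  fixes A :: "real ^ 'n ^ 'n"
  assumes "\<And>i j. ((\<lambda>t. X t $ i $ j) \<longlongrightarrow> A $ i $ j) F"
  shows "((\<lambda>t. det (X t)) \<longlongrightarrow> det A) F"
  unfolding det_def by (intro tendsto_intros assms)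

text \<open>By Cramer's rule each coordinate of the solution is a quotient of determinants, hence
  continuous in the data where the limit determinant is nonzero. Invertibility of
  \<open>X t\<close>, eventually along \<open>F\<close>, comes from convergence of the
  determinants.\<close>

lemma tendsto_linear_system_solution:
  fixes A :: "real ^ 'n ^ 'n"
  assumes X: "(X \<longlongrightarrow> A) F" and b: "(b \<longlongrightarrow> A *v w) F" and A: "invertible A"
    and eq: "\<forall>\<^sub>F t in F. X t *v W t = b t"
  shows "(W \<longlongrightarrow> w) F"
proof -
  have dA: "det A \<noteq> 0" using A by (simp add: invertible_det_nz)
  have dX: "((\<lambda>t. det (X t)) \<longlongrightarrow> det A) F"
    by (intro tendsto_det tendsto_vec_nth X)
  have nz: "\<forall>\<^sub>F t in F. det (X t) \<noteq> 0"
    using tendsto_imp_eventually_ne[OF dX dA] .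
  have sol: "(\<chi> k. det (\<chi> i j. if j = k then (Y *v u) $ i else Y $ i $ j) / det Y) = u"
    if "det Y \<noteq> 0" for Y :: "real ^ 'n ^ 'n" and u
    using cramer[OF that, of u "Y *v u"] by simp
  have w: "w = (\<chi> k. det (\<chi> i j. if j = k then (A *v w) $ i else A $ i $ j) / det A)"
    using sol[OF dA] by simp
  have "((\<lambda>t. \<chi> k. det (\<chi> i j. if j = k then b t $ i else X t $ i $ j) / det (X t)) \<longlongrightarrow>
      (\<chi> k. det (\<chi> i j. if j = k then (A *v w) $ i else A $ i $ j) / det A)) F"
    by (intro tendsto_vec_lambda tendsto_divide tendsto_det dX dA)
      (auto intro!: tendsto_vec_nth X b)
  moreover have "\<forall>\<^sub>F t in F. (\<chi> k. det (\<chi> i j. if j = k then b t $ i else X t $ i $ j) / det (X t)) = W t"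
    using nz eq 
  proof eventually_elim
    case (elim t)
    show ?case using sol[OF elim(1), of "W t"] unfolding elim(2) .
  qed
  ultimately show ?thesis
    unfolding w[symmetric] by (rule Lim_transform_eventually)
qed

section \<open>A maximal ergodic theorem\<close>

text \<open>\<open>max_sum f T n\<close> is the maximum of the first \<open>n + 1\<close> nonempty Birkhoff sums of \<open>f\<close>.\<close>

primrec max_sum :: "('a \<Rightarrow> real) \<Rightarrow> ('a \<Rightarrow> 'a) \<Rightarrow> nat \<Rightarrow> 'a \<Rightarrow> real" where
  "max_sum f T 0 \<omega> = f \<omega>"
| "max_sum f T (Suc n) \<omega> = f \<omega> + max 0 (max_sum f T n (T \<omega>))"

text \<open>Plays the role of the event that the limsup of the averages is positive: it is exactly
  invariant under \<open>T\<close>, and integer thresholds make it a countable combination of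
  measurable events.\<close>

definition unbounded_sums :: "('a \<Rightarrow> real) \<Rightarrow> ('a \<Rightarrow> 'a) \<Rightarrow> 'a \<Rightarrow> bool" where
  "unbounded_sums f T \<omega> \<longleftrightarrow> (\<forall>c::nat. \<exists>n. max_sum f T n \<omega> > c)"

lemma max_sum_mono_Suc: "max_sum f T n \<omega> \<le> max_sum f T (Suc n) \<omega>"
proof (induction n arbitrary: \<omega>)
  case (Suc n)
  show ?case using Suc[of "T \<omega>"] by (subst (1 2) max_sum.simps) linarith
qed simp

lemma max_sum_mono: "m \<le> n \<Longrightarrow> max_sum f T m \<omega> \<le> max_sum f T n \<omega>"
  by (rule lift_Suc_mono_le[where f = "\<lambda>n. max_sum f T n \<omega>"]) (rule max_sum_mono_Suc)

lemma birkhoff_sum_le_max_sum: "(\<Sum>k<Suc n. f ((T ^^ k) \<omega>)) \<le> max_sum f T n \<omega>"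
proof (induction n arbitrary: \<omega>)
  case (Suc n)
  have "(\<Sum>k<Suc (Suc n). f ((T ^^ k) \<omega>)) = f \<omega> + (\<Sum>k<Suc n. f ((T ^^ k) (T \<omega>)))"
    by (subst sum.lessThan_Suc_shift) (simp add: funpow_swap1 del: sum.lessThan_Suc)
  then show ?case using Suc[of "T \<omega>"] by simp
qed simp

text \<open>By the recursion, \<open>max_sum f T (Suc n) \<omega>\<close> differs from the positive
  part of \<open>max_sum f T n (T \<omega>)\<close> by \<open>f \<omega>\<close>, which is
  independent of n.\<close>

lemma unbounded_sums_shift: "unbounded_sums f T (T \<omega>) \<longleftrightarrow> unbounded_sums f T \<omega>"
proof
  assume *: "unbounded_sums f T (T \<omega>)"
  show "unbounded_sums f T \<omega>"
    unfolding unbounded_sums_def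
  proof
    fix c :: nat
    \<comment> \<open>The surplus over c absorbs a possibly negative
      \<open>f \<omega>\<close>.\<close>
    obtain n where "max_sum f T n (T \<omega>) > real (c + nat \<lceil>\<bar>f \<omega>\<bar>\<rceil>)"
      using * unfolding unbounded_sums_def by blast
    then have "max_sum f T (Suc n) \<omega> > c" by simp linarith
    then show "\<exists>n. max_sum f T n \<omega> > c" ..
  qed
next
  assume *: "unbounded_sums f T \<omega>"
  show "unbounded_sums f T (T \<omega>)"
    unfolding unbounded_sums_def
  proof
    fix c :: nat
    obtain n where "max_sum f T n \<omega> > real (c + nat \<lceil>\<bar>f \<omega>\<bar>\<rceil>)"
      using * unfolding unbounded_sums_def by blast
    then have "max_sum f T (Suc n) \<omega> > real (c + nat \<lceil>\<bar>f \<omega>\<bar>\<rceil>)"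
      using max_sum_mono_Suc[of f T n \<omega>] by linarith
    then have "max 0 (max_sum f T n (T \<omega>)) > real c" by simp linarith
    then have "max_sum f T n (T \<omega>) > c" by (simp add: max_def split: if_splits)
    then show "\<exists>n. max_sum f T n (T \<omega>) > c" ..
  qed
qed

lemma unbounded_sums_eventually:
  assumes "unbounded_sums f T \<omega>"
  shows "\<forall>\<^sub>F n in sequentially. max_sum f T n \<omega> > 0"
proof -
  obtain n where "max_sum f T n \<omega> > 0"
    using assms unfolding unbounded_sums_def by (metis of_nat_0)
  then show ?thesis
    unfolding eventually_sequentially using max_sum_mono[of n _ f T \<omega>] by (meson less_le_trans)
qed

section \<open>Measure-preserving maps and Garsia's inequality\<close>

locale measure_preserving = prob_space +
  fixes T
  assumes T_measurable [measurable]: "T \<in> M \<rightarrow>\<^sub>M M" and distr_T: "distr M M T = M"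
begin

lemma integral_T:
  fixes g :: "_ \<Rightarrow> real"
  assumes [measurable]: "g \<in> borel_measurable M"
  shows "integral\<^sup>L M (\<lambda>x. g (T x)) = integral\<^sup>L M g"
  by (subst (2) distr_T[symmetric]) (simp add: integral_distr)

lemma integrable_T:
  fixes g :: "_ \<Rightarrow> real"
  assumes "integrable M g"
  shows "integrable M (\<lambda>x. g (T x))"
proof -
  have [measurable]: "g \<in> borel_measurable M" using assms by simp
  have "integrable (distr M M T) g" using assms by (simp add: distr_T)
  then show ?thesis by (simp add: integrable_distr_eq)
qed

lemma measurable_funpow_T [measurable]: "T ^^ n \<in> M \<rightarrow>\<^sub>M M"
  by (induction n) (simp_all add: id_def measurable_comp)

lemma integrable_max_sum:
  assumes "integrable M f"
  shows "integrable M (max_sum f T n)"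
proof (induction n)
  case 0
  show ?case using assms by (simp cong: integrable_cong)
next
  case (Suc n)
  have "max_sum f T (Suc n) = (\<lambda>\<omega>. f \<omega> + max 0 (max_sum f T n (T \<omega>)))" by auto
  then show ?case using assms integrable_T[OF Suc] by auto
qed

lemma measurable_max_sum:
  assumes [measurable]: "f \<in> borel_measurable M"
  shows "max_sum f T n \<in> borel_measurable M"
proof (induction n)
  case (Suc n)
  note [measurable] = Suc
  have "max_sum f T (Suc n) = (\<lambda>\<omega>. f \<omega> + max 0 (max_sum f T n (T \<omega>)))" by auto
  then show ?case by simp
qed simp

lemma pred_unbounded_sums:
  assumes [measurable]: "f \<in> borel_measurable M"
  shows "Measurable.pred M (unbounded_sums f T)"
proof -
  have [measurable]: "max_sum f T n \<in> borel_measurable M" for n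
    by (rule measurable_max_sum) simp
  show ?thesis unfolding unbounded_sums_def by measurable
qed

text \<open>Garsia's argument: on the invariant set where the sums are unbounded,
  \<open>f\<close> is eventually \<open>max_sum f T (Suc n) - max_sum f T n \<circ> T\<close>, whose integral is that of
  \<open>max_sum f T (Suc n) - max_sum f T n \<ge> 0\<close>.\<close>

lemma maximal_ergodic:
  assumes f: "integrable M f"
  shows "0 \<le> (LINT \<omega>|M. indicator {\<omega>. unbounded_sums f T \<omega>} \<omega> * f \<omega>)"
proof -
  have [measurable]: "f \<in> borel_measurable M" using f by simp
  have [measurable]: "max_sum f T n \<in> borel_measurable M" for n
    by (rule measurable_max_sum) simp
  let ?I = "indicator {\<omega>. unbounded_sums f T \<omega>} :: _ \<Rightarrow> real"
  \<comment> \<open>As max 0 s = s + max (- s) 0, \<open>?g n\<close> is the indicator times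
    \<open>max_sum f T (Suc n) \<omega> - max_sum f T n (T \<omega>)\<close>.\<close>
  let ?g = "\<lambda>n \<omega>. ?I \<omega> * (f \<omega> + max (- max_sum f T n (T \<omega>)) 0)"
  have [measurable]: "?I \<in> borel_measurable M"
    using pred_unbounded_sums[of f] by (auto intro!: borel_measurable_indicator' simp: pred_def)
  have I_T: "?I (T \<omega>) = ?I \<omega>" for \<omega>
    by (simp add: unbounded_sums_shift indicator_def)
  have int: "integrable M (\<lambda>\<omega>. ?I \<omega> * u \<omega>)" if "integrable M u" for u :: "_ \<Rightarrow> real"
  proof (rule Bochner_Integration.integrable_bound[OF that])
    show "(\<lambda>\<omega>. ?I \<omega> * u \<omega>) \<in> borel_measurable M"
      using borel_measurable_integrable[OF that] by simp
  qed (simp add: indicator_def)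
  have m: "integrable M (max_sum f T n)" for n
    by (rule integrable_max_sum[OF f])
  have "(\<lambda>n. integral\<^sup>L M (?g n)) \<longlonglongrightarrow> (LINT \<omega>|M. ?I \<omega> * f \<omega>)"
  proof (rule integral_dominated_convergence)
    show "integrable M (\<lambda>\<omega>. \<bar>f \<omega>\<bar> + \<bar>f (T \<omega>)\<bar>)"
      using f integrable_T[OF f] by auto
    show "AE \<omega> in M. (\<lambda>n. ?g n \<omega>) \<longlonglongrightarrow> ?I \<omega> * f \<omega>"
    proof (intro AE_I2)
      fix \<omega>
      show "(\<lambda>n. ?g n \<omega>) \<longlonglongrightarrow> ?I \<omega> * f \<omega>"
      proof (cases "unbounded_sums f T \<omega>")
        case True
        then have "\<forall>\<^sub>F n in sequentially. max_sum f T n (T \<omega>) > 0"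
          by (intro unbounded_sums_eventually) (simp add: unbounded_sums_shift)
        then have "\<forall>\<^sub>F n in sequentially. ?I \<omega> * f \<omega> = ?g n \<omega>"
          by eventually_elim simp
        then show ?thesis by (rule Lim_transform_eventually[OF tendsto_const])
      qed simp
    qed
    show "AE \<omega> in M. norm (?g n \<omega>) \<le> \<bar>f \<omega>\<bar> + \<bar>f (T \<omega>)\<bar>" for n
    proof (intro AE_I2)
      fix \<omega>
      \<comment> \<open>Bounding the maximum below by its first sum gives a dominating function
        independent of n.\<close>
      have "f (T \<omega>) \<le> max_sum f T n (T \<omega>)" using max_sum_mono[of 0 n f T "T \<omega>"] by simp
      then have "\<bar>f \<omega> + max (- max_sum f T n (T \<omega>)) 0\<bar> \<le> \<bar>f \<omega>\<bar> + \<bar>f (T \<omega>)\<bar>" by linarith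
      then show "norm (?g n \<omega>) \<le> \<bar>f \<omega>\<bar> + \<bar>f (T \<omega>)\<bar>" by (simp add: indicator_def)
    qed
  qed measurable
  moreover have "0 \<le> integral\<^sup>L M (?g n)" for n
  proof -
    have "0 \<le> (LINT \<omega>|M. ?I \<omega> * (max_sum f T (Suc n) \<omega> - max_sum f T n \<omega>))"
      by (intro integral_nonneg_AE AE_I2 mult_nonneg_nonneg)
        (simp_all add: max_sum_mono_Suc del: max_sum.simps)
    also have "\<dots> = (LINT \<omega>|M. ?I \<omega> * max_sum f T (Suc n) \<omega>) - (LINT \<omega>|M. ?I \<omega> * max_sum f T n \<omega>)"
      unfolding right_diff_distrib by (intro Bochner_Integration.integral_diff int m)
    \<comment> \<open>The indicator is invariant, so the product may be composed with
      \<open>T\<close> without changing its integral.\<close>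
    also have "(LINT \<omega>|M. ?I \<omega> * max_sum f T n \<omega>) = (LINT \<omega>|M. ?I \<omega> * max_sum f T n (T \<omega>))"
      using integral_T[of "\<lambda>\<omega>. ?I \<omega> * max_sum f T n \<omega>"] by (simp add: I_T)
    also have "(LINT \<omega>|M. ?I \<omega> * max_sum f T (Suc n) \<omega>) - \<dots>
        = (LINT \<omega>|M. ?I \<omega> * max_sum f T (Suc n) \<omega> - ?I \<omega> * max_sum f T n (T \<omega>))"
      by (intro Bochner_Integration.integral_diff[symmetric] int m integrable_T)
    also have "\<dots> = integral\<^sup>L M (?g n)"
      by (intro Bochner_Integration.integral_cong) (auto simp: algebra_simps max_def)
    finally show ?thesis .
  qed
  ultimately show ?thesis
    by (intro LIMSEQ_le_const) auto
qed

end

section \<open>Random iterations with a unique invariant law\<close>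

lemma emeasure_distr_nn_integral:
  assumes "f \<in> M \<rightarrow>\<^sub>M N" "A \<in> sets N"
  shows "emeasure (distr M N f) A = (\<integral>\<^sup>+ x. indicator A (f x) \<partial>M)"
  using nn_integral_distr[OF assms(1), of "indicator A"] assms(2) by simp

text \<open>A Markov kernel is encoded as a map fed with independent noise: the state X moves to
  \<open>F (X, \<xi>)\<close> with \<xi> of law \<open>N\<close>. The target \<nu> in
  \<open>distr (\<nu>' \<Otimes>\<^sub>M N) \<nu> F\<close> only supplies the sigma-algebra.\<close>

locale random_iteration =
  inv: prob_space \<nu> + noise: prob_space N
  for \<nu> :: "'a measure" and N :: "'b measure" +
  fixes F :: "'a \<times> 'b \<Rightarrow> 'a"
  assumes F [measurable]: "F \<in> \<nu> \<Otimes>\<^sub>M N \<rightarrow>\<^sub>M \<nu>"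
    and invariant: "distr (\<nu> \<Otimes>\<^sub>M N) \<nu> F = \<nu>"
    and unique: "\<And>\<nu>'. prob_space \<nu>' \<Longrightarrow> sets \<nu>' = sets \<nu> \<Longrightarrow> distr (\<nu>' \<Otimes>\<^sub>M N) \<nu> F = \<nu>' \<Longrightarrow> \<nu>' = \<nu>"
begin

definition runs :: "('a \<times> 'b stream) measure" where
  "runs = \<nu> \<Otimes>\<^sub>M stream_space N"

text \<open>The stream holds the noise still to come, so a pair determines its whole future and the
  Markov process becomes a deterministic dynamical system.\<close>

definition advance :: "'a \<times> 'b stream \<Rightarrow> 'a \<times> 'b stream" where
  "advance = (\<lambda>(X, \<omega>). (F (X, shd \<omega>), stl \<omega>))"

sublocale noise_stream: prob_space "stream_space N"
  by (rule noise.prob_space_stream_space)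

sublocale step: pair_prob_space \<nu> N ..

sublocale run: pair_prob_space \<nu> "stream_space N" ..

lemma nn_integral_step:
  assumes [measurable]: "g \<in> borel_measurable \<nu>"
  shows "(\<integral>\<^sup>+ p. g (F p) \<partial>(\<nu> \<Otimes>\<^sub>M N)) = (\<integral>\<^sup>+ X. g X \<partial>\<nu>)"
  by (subst (2) invariant[symmetric]) (simp add: nn_integral_distr)

lemma integral_step:
  fixes g :: "'a \<Rightarrow> real"
  assumes [measurable]: "g \<in> borel_measurable \<nu>"
  shows "(LINT p|(\<nu> \<Otimes>\<^sub>M N). g (F p)) = (LINT X|\<nu>. g X)"
  by (subst (2) invariant[symmetric]) (simp add: integral_distr)

text \<open>The head of an i.i.d. stream is independent of the tail, and the tail has the law of the
  full stream. After one step the state \<open>F (X, \<xi>)\<close> has law \<nu> by invariance and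
  is still independent of the remaining noise.\<close>

sublocale measure_preserving runs advance
proof (intro measure_preserving.intro measure_preserving_axioms.intro)
  show "prob_space runs"
    unfolding runs_def by (rule run.prob_space_axioms)
  show T [measurable]: "advance \<in> runs \<rightarrow>\<^sub>M runs"
    unfolding runs_def advance_def by measurable
  show "distr runs runs advance = runs"
  proof (rule measure_eqI)
    fix A assume "A \<in> sets (distr runs runs advance)"
    then have [measurable]: "A \<in> sets (\<nu> \<Otimes>\<^sub>M stream_space N)" by (simp add: runs_def)
    have [measurable]: "advance \<in> \<nu> \<Otimes>\<^sub>M stream_space N \<rightarrow>\<^sub>M \<nu> \<Otimes>\<^sub>M stream_space N"
      using T by (simp add: runs_def)
    have "emeasure (distr runs runs advance) A = (\<integral>\<^sup>+ p. indicator A (advance p) \<partial>runs)"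
      by (rule emeasure_distr_nn_integral) (simp_all add: runs_def)
    also have "\<dots> = (\<integral>\<^sup>+ X. \<integral>\<^sup>+ \<omega>. indicator A (advance (X, \<omega>)) \<partial>stream_space N \<partial>\<nu>)"
      unfolding runs_def by (rule noise_stream.nn_integral_fst[symmetric]) measurable
    also have "\<dots> = (\<integral>\<^sup>+ X. \<integral>\<^sup>+ \<xi>. \<integral>\<^sup>+ \<omega>. indicator A (F (X, \<xi>), \<omega>) \<partial>stream_space N \<partial>N \<partial>\<nu>)"
      by (intro nn_integral_cong, subst noise.nn_integral_stream_space) (auto simp: advance_def)
    also have "\<dots> = (\<integral>\<^sup>+ p. (\<integral>\<^sup>+ \<omega>. indicator A (F p, \<omega>) \<partial>stream_space N) \<partial>(\<nu> \<Otimes>\<^sub>M N))"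
      by (subst noise.nn_integral_fst[symmetric]) auto
    also have "\<dots> = (\<integral>\<^sup>+ X. \<integral>\<^sup>+ \<omega>. indicator A (X, \<omega>) \<partial>stream_space N \<partial>\<nu>)"
      by (rule nn_integral_step) measurable
    also have "\<dots> = emeasure runs A"
      unfolding runs_def by (subst noise_stream.nn_integral_fst) auto
    finally show "emeasure (distr runs runs advance) A = emeasure runs A" .
  qed simp
qed

lemma space_F: "X \<in> space \<nu> \<Longrightarrow> \<xi> \<in> space N \<Longrightarrow> F (X, \<xi>) \<in> space \<nu>"
  using F by (auto simp: measurable_def space_pair_measure)

text \<open>The mean square of \<open>h (F p) - h (fst p)\<close> vanishes: both squares have mean
  E[h^2] by invariance, and integrating out the noise turns the mixed term into E[h^2] by
  harmonicity.\<close>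

lemma harmonic_invariant:
  assumes h [measurable]: "h \<in> borel_measurable \<nu>" and h01: "\<And>X. 0 \<le> h X" "\<And>X. h X \<le> (1::real)"
    and harmonic: "\<And>X. X \<in> space \<nu> \<Longrightarrow> h X = (LINT \<xi>|N. h (F (X, \<xi>)))"
  shows "AE p in \<nu> \<Otimes>\<^sub>M N. h (F p) = h (fst p)"
proof -
  let ?P = "\<nu> \<Otimes>\<^sub>M N"
  have bnd: "integrable ?P u" if [measurable]: "u \<in> borel_measurable ?P" and "\<And>p. \<bar>u p\<bar> \<le> 1" for u :: "_ \<Rightarrow> real"
    by (rule step.integrable_const_bound[where B = 1]) (use that in auto)
  have hh: "\<bar>h X * h Y\<bar> \<le> 1" for X Y
    using mult_mono[of "h X" 1 "h Y" 1] h01 by (simp add: abs_mult)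
  have i: "integrable ?P (\<lambda>p. h (F p) * h (F p))" "integrable ?P (\<lambda>p. h (fst p) * h (fst p))"
     "integrable ?P (\<lambda>p. h (fst p) * h (F p))"
    by (intro bnd hh; measurable)+
  have "(LINT p|?P. h (fst p) * h (fst p)) = (LINT X|\<nu>. LINT \<xi>|N. h X * h X)"
    using step.integral_fst'[OF i(2)] by simp
  then have 1: "(LINT p|?P. h (fst p) * h (fst p)) = (LINT X|\<nu>. h X * h X)"
    by (simp add: noise.prob_space)
  have 2: "(LINT p|?P. h (F p) * h (F p)) = (LINT X|\<nu>. h X * h X)"
    by (rule integral_step) measurable
  have "(LINT p|?P. h (fst p) * h (F p)) = (LINT X|\<nu>. LINT \<xi>|N. h X * h (F (X, \<xi>)))"
    using step.integral_fst'[OF i(3)] by simp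
  also have "\<dots> = (LINT X|\<nu>. h X * h X)"
    using harmonic by (intro Bochner_Integration.integral_cong) simp_all
  finally have 3: "(LINT p|?P. h (fst p) * h (F p)) = (LINT X|\<nu>. h X * h X)" .
  have eq: "(h (F p) - h (fst p))\<^sup>2
      = h (F p) * h (F p) + h (fst p) * h (fst p) - 2 * (h (fst p) * h (F p))" for p
    by (simp add: power2_eq_square algebra_simps)
  have "(LINT p|?P. (h (F p) - h (fst p))\<^sup>2) = 0"
    unfolding eq using i 1 2 3 by simp
  moreover have "integrable ?P (\<lambda>p. (h (F p) - h (fst p))\<^sup>2)"
    unfolding eq using i by simp
  ultimately have "AE p in ?P. (h (F p) - h (fst p))\<^sup>2 = 0"
    by (subst (asm) integral_nonneg_eq_0_iff_AE) auto
  then show ?thesis by simp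
qed

text \<open>The tilted law \<open>density \<nu> (h / c)\<close> is again invariant, hence equal to \<open>\<nu>\<close>.\<close>

lemma harmonic_uncorrelated:
  assumes h [measurable]: "h \<in> borel_measurable \<nu>" and h01: "\<And>X. 0 \<le> h X" "\<And>X. h X \<le> (1::real)"
    and harmonic: "\<And>X. X \<in> space \<nu> \<Longrightarrow> h X = (LINT \<xi>|N. h (F (X, \<xi>)))"
    and f: "integrable \<nu> f"
  shows "(LINT X|\<nu>. h X * f X) = (LINT X|\<nu>. h X) * (LINT X|\<nu>. f X)"
proof (cases "(LINT X|\<nu>. h X) = 0")
  case True
  \<comment> \<open>A nonnegative \<open>h\<close> of mean 0 vanishes almost everywhere, so both
    sides are 0 and no tilting is possible.\<close>
  have "integrable \<nu> h"
    by (rule inv.integrable_const_bound[where B = 1]) (use h01 in auto)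
  then have "AE X in \<nu>. h X = 0"
    using True h01 by (subst (asm) integral_nonneg_eq_0_iff_AE) auto
  then have "(LINT X|\<nu>. h X * f X) = (LINT X|\<nu>. 0)"
    using f by (intro integral_cong_AE) auto
  then show ?thesis using True by simp
next
  case False
  define c where "c = (LINT X|\<nu>. h X)"
  have c: "c > 0" using False h01 unfolding c_def by (simp add: less_le Bochner_Integration.integral_nonneg)
  have ih: "integrable \<nu> h"
    by (rule inv.integrable_const_bound[where B = 1]) (use h01 in auto)
  define \<nu>' where "\<nu>' = density \<nu> (\<lambda>X. ennreal (h X / c))"
  have sets': "sets \<nu>' = sets \<nu>" by (simp add: \<nu>'_def)
  have "prob_space \<nu>'"
  proof
    have "emeasure \<nu>' (space \<nu>') = (\<integral>\<^sup>+ X. ennreal (h X / c) \<partial>\<nu>)"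
      by (simp add: \<nu>'_def emeasure_density cong: nn_integral_cong)
    also have "\<dots> = ennreal (LINT X|\<nu>. h X / c)"
      using ih c h01 by (intro nn_integral_eq_integral) auto
    finally show "emeasure \<nu>' (space \<nu>') = 1" using c by (simp add: c_def)
  qed
  moreover have "distr (\<nu>' \<Otimes>\<^sub>M N) \<nu> F = \<nu>'"
  proof (rule measure_eqI)
    fix A assume "A \<in> sets (distr (\<nu>' \<Otimes>\<^sub>M N) \<nu> F)"
    then have A [measurable]: "A \<in> sets \<nu>" by simp
    have [measurable_cong]: "sets \<nu>' = sets \<nu>" by (rule sets')
    have [measurable]: "F \<in> \<nu>' \<Otimes>\<^sub>M N \<rightarrow>\<^sub>M \<nu>" by measurable
    interpret \<nu>': prob_space \<nu>' by fact
    have "emeasure (distr (\<nu>' \<Otimes>\<^sub>M N) \<nu> F) A = (\<integral>\<^sup>+ p. indicator A (F p) \<partial>(\<nu>' \<Otimes>\<^sub>M N))"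
      by (rule emeasure_distr_nn_integral) simp_all
    also have "\<dots> = (\<integral>\<^sup>+ X. \<integral>\<^sup>+ \<xi>. indicator A (F (X, \<xi>)) \<partial>N \<partial>\<nu>')"
      by (rule noise.nn_integral_fst[symmetric]) measurable
    also have "\<dots> = (\<integral>\<^sup>+ X. ennreal (h X / c) * (\<integral>\<^sup>+ \<xi>. indicator A (F (X, \<xi>)) \<partial>N) \<partial>\<nu>)"
      unfolding \<nu>'_def by (rule nn_integral_density) measurable
    also have "\<dots> = (\<integral>\<^sup>+ X. \<integral>\<^sup>+ \<xi>. ennreal (h X / c) * indicator A (F (X, \<xi>)) \<partial>N \<partial>\<nu>)"
      by (intro nn_integral_cong nn_integral_cmult[symmetric]) measurable
    also have "\<dots> = (\<integral>\<^sup>+ p. ennreal (h (fst p) / c) * indicator A (F p) \<partial>(\<nu> \<Otimes>\<^sub>M N))"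
      by (subst noise.nn_integral_fst[symmetric]) auto
    \<comment> \<open>Almost sure invariance of \<open>h\<close> moves the weight to the state after
      the step, so that invariance of \<nu> applies to the whole integrand.\<close>
    also have "\<dots> = (\<integral>\<^sup>+ p. ennreal (h (F p) / c) * indicator A (F p) \<partial>(\<nu> \<Otimes>\<^sub>M N))"
      using harmonic_invariant[OF h h01 harmonic] by (intro nn_integral_cong_AE) auto
    also have "\<dots> = (\<integral>\<^sup>+ X. ennreal (h X / c) * indicator A X \<partial>\<nu>)"
      by (rule nn_integral_step) measurable
    also have "\<dots> = emeasure \<nu>' A"
      by (simp add: \<nu>'_def emeasure_density)
    finally show "emeasure (distr (\<nu>' \<Otimes>\<^sub>M N) \<nu> F) A = emeasure \<nu>' A" .
  qed (simp add: sets')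
  ultimately have eq: "\<nu>' = \<nu>" using sets' by (intro unique)
  have "(LINT X|\<nu>. f X) = (LINT X|\<nu>'. f X)" by (simp add: eq)
  also have "\<dots> = (LINT X|\<nu>. (h X / c) * f X)"
    unfolding \<nu>'_def using f c h01 by (subst integral_density) auto
  also have "\<dots> = (LINT X|\<nu>. h X * f X) / c"
    by (simp add: mult.commute)
  finally show ?thesis using c by (simp add: c_def[symmetric] field_simps)
qed

section \<open>Birkhoff's theorem for runs started in the invariant law\<close>

lemma distr_runs_fst: "distr runs \<nu> fst = \<nu>"
  unfolding runs_def by (rule noise_stream.distr_pair_fst)

lemma integrable_runs_fst:
  assumes "integrable \<nu> (f :: 'a \<Rightarrow> real)"
  shows "integrable runs (\<lambda>p. f (fst p))"
proof -
  have "fst \<in> runs \<rightarrow>\<^sub>M \<nu>" unfolding runs_def by measurable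
  moreover have "integrable (distr runs \<nu> fst) f" using assms by (simp add: distr_runs_fst)
  ultimately show ?thesis by (rule integrable_distr)
qed

text \<open>Let B be the event of unbounded sums and h its conditional probability given the initial
  state. The maximal inequality and the product formula for harmonic functions give 0 \<le> E[1_B f]
  = E[h f] = E[h] E[f]. As E[f] < 0, this forces E[h] = 0, that is, B is null.\<close>

lemma bounded_sums:
  assumes f: "integrable \<nu> f" and neg: "(LINT X|\<nu>. f X) < 0"
  shows "AE p in runs. \<not> unbounded_sums (\<lambda>p. f (fst p)) advance p"
proof -
  let ?f = "\<lambda>p. f (fst p)"
  let ?B = "{p. unbounded_sums ?f advance p}"
  let ?S = "stream_space N"
  have [measurable]: "f \<in> borel_measurable \<nu>" using f by simp
  have f' [measurable]: "?f \<in> borel_measurable runs" unfolding runs_def by measurable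
  have iB [measurable]: "(indicator ?B :: _ \<Rightarrow> real) \<in> borel_measurable runs"
    using pred_unbounded_sums[OF f'] by (auto intro!: borel_measurable_indicator' simp: pred_def)
  then have iB' [measurable]: "(indicator ?B :: _ \<Rightarrow> real) \<in> borel_measurable (\<nu> \<Otimes>\<^sub>M ?S)"
    by (simp add: runs_def)
  have fint: "integrable runs ?f"
    by (rule integrable_runs_fst[OF f])
  have Bint: "integrable runs (indicator ?B :: _ \<Rightarrow> real)"
    by (rule integrable_const_bound[where B = 1]) auto
  have Bfint: "integrable runs (\<lambda>p. indicator ?B p * ?f p)"
  proof (rule Bochner_Integration.integrable_bound[OF fint])
    show "(\<lambda>p. indicator ?B p * ?f p) \<in> borel_measurable runs" by simp
  qed (simp add: indicator_def)
  define h :: "'a \<Rightarrow> real" where "h X = (LINT \<omega>|?S. indicator ?B (X, \<omega>))" for X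
  have h [measurable]: "h \<in> borel_measurable \<nu>"
    unfolding h_def using iB'
    by (intro noise_stream.borel_measurable_lebesgue_integral) simp
  have h01: "0 \<le> h X" "h X \<le> 1" for X
  proof -
    show "0 \<le> h X" unfolding h_def by (rule Bochner_Integration.integral_nonneg) simp
    have "h X \<le> (LINT \<omega>|?S. 1)"
      unfolding h_def by (rule integral_mono') (simp_all add: indicator_def)
    then show "h X \<le> 1" by (simp add: noise_stream.prob_space)
  qed
  \<comment> \<open>Split off the first noise letter; invariance of the event replaces the run from
    X by the advanced run from \<open>F (X, \<xi>)\<close>.\<close>
  have harmonic: "h X = (LINT \<xi>|N. h (F (X, \<xi>)))" if [measurable]: "X \<in> space \<nu>" for X
  proof -
    have nn: "ennreal (h Y) = (\<integral>\<^sup>+ \<omega>. ennreal (indicator ?B (Y, \<omega>)) \<partial>?S)" if [measurable]: "Y \<in> space \<nu>" for Y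
      unfolding h_def
      by (intro nn_integral_eq_integral[symmetric] noise_stream.integrable_const_bound[where B = 1])
        auto
    have "ennreal (h X) = (\<integral>\<^sup>+ \<xi>. \<integral>\<^sup>+ \<omega>. ennreal (indicator ?B (X, \<xi> ## \<omega>)) \<partial>?S \<partial>N)"
      unfolding nn[OF that]
      by (subst noise.nn_integral_stream_space) auto
    also have "\<dots> = (\<integral>\<^sup>+ \<xi>. \<integral>\<^sup>+ \<omega>. ennreal (indicator ?B (F (X, \<xi>), \<omega>)) \<partial>?S \<partial>N)"
    proof (intro nn_integral_cong)
      fix \<xi> \<omega>
      show "ennreal (indicator ?B (X, \<xi> ## \<omega>)) = ennreal (indicator ?B (F (X, \<xi>), \<omega>))"
        using unbounded_sums_shift[of ?f advance "(X, \<xi> ## \<omega>)"] by (simp add: advance_def indicator_def)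
    qed
    also have "\<dots> = (\<integral>\<^sup>+ \<xi>. ennreal (h (F (X, \<xi>))) \<partial>N)"
      using space_F[OF that] by (intro nn_integral_cong nn[symmetric])
    also have "\<dots> = ennreal (LINT \<xi>|N. h (F (X, \<xi>)))"
      using h01 by (intro nn_integral_eq_integral noise.integrable_const_bound[where B = 1]) auto
    finally show ?thesis using h01 by (simp add: Bochner_Integration.integral_nonneg)
  qed
  have "(LINT p|runs. indicator ?B p * ?f p) = (LINT X|\<nu>. LINT \<omega>|?S. indicator ?B (X, \<omega>) * f X)"
    using run.integral_fst'[OF Bfint[unfolded runs_def]] by (simp add: runs_def)
  then have hf: "(LINT p|runs. indicator ?B p * ?f p) = (LINT X|\<nu>. h X * f X)"
    by (simp add: h_def)
  have "0 \<le> (LINT p|runs. indicator ?B p * ?f p)"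
    by (rule maximal_ergodic[OF fint])
  also have "\<dots> = (LINT X|\<nu>. h X) * (LINT X|\<nu>. f X)"
    unfolding hf by (rule harmonic_uncorrelated[OF h h01 harmonic f])
  finally have "(LINT X|\<nu>. h X) \<le> 0"
    using neg by (simp add: zero_le_mult_iff)
  moreover have "(LINT X|\<nu>. h X) = (LINT p|runs. indicator ?B p)"
    using run.integral_fst'[OF Bint[unfolded runs_def]] by (simp add: h_def runs_def)
  moreover have "0 \<le> (LINT p|runs. indicator ?B p :: real)"
    by (rule Bochner_Integration.integral_nonneg) simp
  ultimately have "(LINT p|runs. indicator ?B p :: real) = 0" by linarith
  then have "AE p in runs. (indicator ?B p :: real) = 0"
    using Bint by (subst (asm) integral_nonneg_eq_0_iff_AE) auto
  then show ?thesis by eventually_elim (simp add: indicator_def split: if_splits)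
qed

lemma birkhoff_average_upper:
  assumes f: "integrable \<nu> f" and e: "e > 0"
  shows "AE p in runs. \<forall>\<^sub>F n in sequentially.
    (\<Sum>k<n. f (fst ((advance ^^ k) p))) / n < (LINT X|\<nu>. f X) + e"
proof -
  \<comment> \<open>Half of \<open>e\<close> makes the mean of \<open>f - m\<close> negative; the
    other half absorbs the bound \<open>c\<close> on its sums after division by n.\<close>
  define m where "m = (LINT X|\<nu>. f X) + e / 2"
  let ?g = "\<lambda>X. f X - m"
  have "(LINT X|\<nu>. ?g X) = - e / 2"
    using f by (simp add: m_def inv.prob_space)
  then have "AE p in runs. \<not> unbounded_sums (\<lambda>p. ?g (fst p)) advance p"
    using f e by (intro bounded_sums) auto
  then show ?thesis
  proof eventually_elim
    case (elim p)
    then obtain c :: nat where c: "max_sum (\<lambda>p. ?g (fst p)) advance n p \<le> c" for n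
      unfolding unbounded_sums_def by (auto simp: not_less)
    have le: "(\<Sum>k<n. f (fst ((advance ^^ k) p))) \<le> c + n * m" if pos: "n > 0" for n
    proof -
      obtain n' where n: "n = Suc n'" using pos gr0_implies_Suc by blast
      have "(\<Sum>k<n. ?g (fst ((advance ^^ k) p))) \<le> c"
        using birkhoff_sum_le_max_sum[of "\<lambda>p. ?g (fst p)" advance p n'] c[of n'] by (simp add: n del: sum.lessThan_Suc)
      then show ?thesis by (simp add: sum_subtractf)
    qed
    have "\<forall>\<^sub>F n in sequentially. n > nat \<lceil>2 * c / e\<rceil>" by (rule eventually_gt_at_top)
    then show ?case
    proof eventually_elim
      case (elim n)
      then have "n > 0" "real n > 2 * c / e" by linarith+
      then have "c < n * (e / 2)" using e by (simp add: field_simps)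
      then have "(\<Sum>k<n. f (fst ((advance ^^ k) p))) < n * (m + e / 2)"
        using le[OF \<open>n > 0\<close>] by (simp add: algebra_simps)
      then show ?case using \<open>n > 0\<close> by (simp add: m_def field_simps)
    qed
  qed
qed

text \<open>The upper bound is applied to \<open>f\<close> and to \<open>- f\<close>, with
  tolerances 1 / (j + 1) so that only countably many null sets are joined.\<close>

theorem birkhoff_average:
  assumes f: "integrable \<nu> f"
  shows "AE p in runs. (\<lambda>n. (\<Sum>k<n. f (fst ((advance ^^ k) p))) / n) \<longlonglongrightarrow> (LINT X|\<nu>. f X)"
proof -
  have "AE p in runs. \<forall>j. \<forall>\<^sub>F n in sequentially.
      (\<Sum>k<n. f (fst ((advance ^^ k) p))) / n < (LINT X|\<nu>. f X) + 1 / Suc j"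
    unfolding AE_all_countable by (intro allI birkhoff_average_upper f) simp
  moreover have "AE p in runs. \<forall>j. \<forall>\<^sub>F n in sequentially.
      (\<Sum>k<n. - f (fst ((advance ^^ k) p))) / n < (LINT X|\<nu>. - f X) + 1 / Suc j"
    unfolding AE_all_countable using f by (intro allI birkhoff_average_upper) auto
  ultimately show ?thesis
  proof eventually_elim
    case (elim p)
    let ?a = "\<lambda>n. (\<Sum>k<n. f (fst ((advance ^^ k) p))) / n"
    show ?case
    proof (rule tendstoI)
      fix e :: real assume "e > 0"
      then obtain j where j: "1 / Suc j < e" using nat_approx_posE by blast
      from elim(1)[rule_format, of j] elim(2)[rule_format, of j]
      show "\<forall>\<^sub>F n in sequentially. dist (?a n) (LINT X|\<nu>. f X) < e"
        by eventually_elim (use j in \<open>auto simp: dist_real_def sum_negf\<close>)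
    qed
  qed
qed

end

section \<open>The invariant law of the temporal difference process\<close>

abbreviation td_space :: "('s::countable \<times> 's \<times> (real ^ 'n)) measure" where
  "td_space \<equiv> count_space UNIV \<Otimes>\<^sub>M count_space UNIV \<Otimes>\<^sub>M borel"

lemma borel_measurable_vec_nth [measurable (raw)]:
  fixes f :: "'a \<Rightarrow> real ^ 'n"
  assumes "f \<in> borel_measurable M"
  shows "(\<lambda>x. f x $ a) \<in> borel_measurable M"
  by (rule measurable_compose[OF assms borel_measurable_continuous_onI])
    (intro continuous_intros)

text \<open>An independent successor is drawn for every state, so that a step of the chain becomes
  the deterministic map \<open>td_step\<close>.\<close>

abbreviation successors :: "('s::countable \<Rightarrow> 's pmf) \<Rightarrow> ('s \<Rightarrow> 's) measure" where
  "successors K \<equiv> PiM UNIV (\<lambda>s. measure_pmf (K s))"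

definition td_step :: "real \<Rightarrow> ('s \<Rightarrow> real ^ 'n) \<Rightarrow>
    ('s \<times> 's \<times> (real ^ 'n)) \<times> ('s \<Rightarrow> 's) \<Rightarrow> 's \<times> 's \<times> (real ^ 'n)" where
  "td_step \<beta> \<phi> = (\<lambda>((i, j, z), \<xi>). (j, \<xi> j, \<beta> *\<^sub>R z + \<phi> j))"

lemma prob_space_successors: "prob_space (successors K)"
  by (intro prob_space_PiM prob_space_measure_pmf)

lemma measurable_successor [measurable]: "(\<lambda>\<xi>. \<xi> j) \<in> successors K \<rightarrow>\<^sub>M count_space UNIV"
proof -
  have "(\<lambda>\<xi>. \<xi> j) \<in> successors K \<rightarrow>\<^sub>M measure_pmf (K j)"
    by (rule measurable_component_singleton) simp
  then show ?thesis by simp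
qed

lemma distr_successor: "distr (successors K) (measure_pmf (K j)) (\<lambda>\<xi>. \<xi> j) = measure_pmf (K j)"
  by (rule distr_PiM_component) (auto intro: prob_space_measure_pmf)

lemma measurable_td_step [measurable]:
  "td_step \<beta> \<phi> \<in> td_space \<Otimes>\<^sub>M successors K \<rightarrow>\<^sub>M td_space"
proof -
  \<comment> \<open>Which coordinate of the noise is read depends on the state; measurability
    follows by splitting over the countably many states.\<close>
  have 1: "(\<lambda>p. snd p (fst (snd (fst p)))) \<in> (td_space :: ('a \<times> 'a \<times> (real ^ 'b)) measure)
      \<Otimes>\<^sub>M successors K \<rightarrow>\<^sub>M count_space UNIV"
    by (rule measurable_compose_countable[of "\<lambda>j p. snd p j"]) measurable
  have 2: "td_step \<beta> \<phi> = (\<lambda>p. (fst (snd (fst p)), snd p (fst (snd (fst p))),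
      \<beta> *\<^sub>R snd (snd (fst p)) + \<phi> (fst (snd (fst p)))))"
    by (auto simp: td_step_def)
  show ?thesis
    unfolding 2 using 1 by measurable
qed

text \<open>Of all the successors drawn, a step reads only \<open>\<xi> j\<close>, whose law is
  \<open>K j\<close>. This links the noise form of the kernel to the form used in
  \<open>td_invariant\<close>.\<close>

lemma emeasure_distr_td_step:
  assumes "prob_space \<nu>" and sets_nu [measurable_cong]: "sets \<nu> = sets td_space"
    and B [measurable]: "B \<in> sets td_space"
  shows "emeasure (distr (\<nu> \<Otimes>\<^sub>M successors K) td_space (td_step \<beta> \<phi>)) B =
    (\<integral>\<^sup>+ (i, j, z). emeasure (measure_pmf (K j)) {k. (j, k, \<beta> *\<^sub>R z + \<phi> j) \<in> B} \<partial>\<nu>)"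
proof -
  interpret N: prob_space "successors K" by (rule prob_space_successors)
  have [measurable]: "td_step \<beta> \<phi> \<in> \<nu> \<Otimes>\<^sub>M successors K \<rightarrow>\<^sub>M td_space" by measurable
  have "emeasure (distr (\<nu> \<Otimes>\<^sub>M successors K) td_space (td_step \<beta> \<phi>)) B
      = (\<integral>\<^sup>+ p. indicator B (td_step \<beta> \<phi> p) \<partial>(\<nu> \<Otimes>\<^sub>M successors K))"
    by (rule emeasure_distr_nn_integral) simp_all
  also have "\<dots> = (\<integral>\<^sup>+ X. \<integral>\<^sup>+ \<xi>. indicator B (td_step \<beta> \<phi> (X, \<xi>)) \<partial>successors K \<partial>\<nu>)"
    by (rule N.nn_integral_fst[symmetric]) measurable
  also have "\<dots> = (\<integral>\<^sup>+ (i, j, z). emeasure (measure_pmf (K j)) {k. (j, k, \<beta> *\<^sub>R z + \<phi> j) \<in> B} \<partial>\<nu>)"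
  proof (intro nn_integral_cong, clarify)
    fix i j and z :: "real ^ 'b"
    have "(\<integral>\<^sup>+ \<xi>. indicator B (td_step \<beta> \<phi> ((i, j, z), \<xi>)) \<partial>successors K)
        = (\<integral>\<^sup>+ \<xi>. indicator {k. (j, k, \<beta> *\<^sub>R z + \<phi> j) \<in> B} (\<xi> j) \<partial>successors K)"
      by (intro nn_integral_cong) (simp add: td_step_def indicator_def)
    also have "\<dots> = (\<integral>\<^sup>+ k. indicator {k. (j, k, \<beta> *\<^sub>R z + \<phi> j) \<in> B} k
        \<partial>distr (successors K) (measure_pmf (K j)) (\<lambda>\<xi>. \<xi> j))"
      by (rule nn_integral_distr[symmetric]) simp_all
    also have "\<dots> = emeasure (measure_pmf (K j)) {k. (j, k, \<beta> *\<^sub>R z + \<phi> j) \<in> B}"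
      unfolding distr_successor by simp
    finally show "(\<integral>\<^sup>+ \<xi>. indicator B (td_step \<beta> \<phi> ((i, j, z), \<xi>)) \<partial>successors K)
        = emeasure (measure_pmf (K j)) {k. (j, k, \<beta> *\<^sub>R z + \<phi> j) \<in> B}" .
  qed
  finally show ?thesis .
qed

lemma td_invariant_iff:
  "td_invariant K \<gamma> lam \<phi> \<nu> \<longleftrightarrow> prob_space \<nu> \<and> sets \<nu> = sets td_space \<and>
     distr (\<nu> \<Otimes>\<^sub>M successors K) \<nu> (td_step (\<gamma> * lam) \<phi>) = \<nu>"
proof -
  have eq: "distr (\<nu> \<Otimes>\<^sub>M successors K) \<nu> (td_step (\<gamma> * lam) \<phi>)
      = distr (\<nu> \<Otimes>\<^sub>M successors K) td_space (td_step (\<gamma> * lam) \<phi>)"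
    if "sets \<nu> = sets td_space" by (rule distr_cong) (simp_all add: that)
  have "(\<forall>B\<in>sets \<nu>. emeasure \<nu> B = (\<integral>\<^sup>+ (i, j, z). emeasure (measure_pmf (K j))
        {k. (j, k, (\<gamma> * lam) *\<^sub>R z + \<phi> j) \<in> B} \<partial>\<nu>)) \<longleftrightarrow>
      distr (\<nu> \<Otimes>\<^sub>M successors K) \<nu> (td_step (\<gamma> * lam) \<phi>) = \<nu>" (is "?L \<longleftrightarrow> ?D = \<nu>")
    if "prob_space \<nu>" and sets: "sets \<nu> = sets td_space"
  proof -
    have "?L \<longleftrightarrow> (\<forall>B\<in>sets \<nu>. emeasure \<nu> B = emeasure ?D B)"
      unfolding eq[OF sets] using emeasure_distr_td_step[OF that] sets by (intro ball_cong) simp_all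
    also have "\<dots> \<longleftrightarrow> ?D = \<nu>"
    proof
      assume "\<forall>B\<in>sets \<nu>. emeasure \<nu> B = emeasure ?D B"
      then show "?D = \<nu>" by (intro measure_eqI) simp_all
    qed simp
    finally show ?thesis .
  qed
  then show ?thesis unfolding td_invariant_def by blast
qed

section \<open>Translations of the trace and the contraction factor\<close>

lemma distr_td_translate_invariant:
  fixes c :: "real ^ 'n" and \<phi> :: "'s::countable \<Rightarrow> real ^ 'n"
  assumes inv: "td_invariant K \<gamma> lam \<phi> \<nu>" and "\<gamma> * lam = 1"
  shows "td_invariant K \<gamma> lam \<phi> (distr \<nu> td_space (\<lambda>(i, j, z). (i, j, z + c)))"
proof -
  define s :: "'s \<times> 's \<times> (real ^ 'n) \<Rightarrow> 's \<times> 's \<times> (real ^ 'n)"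
    where "s = (\<lambda>(i, j, z). (i, j, z + c))"
  let ?F = "td_step 1 \<phi>" and ?N = "successors K"
  have inv': "prob_space \<nu>" "distr (\<nu> \<Otimes>\<^sub>M ?N) \<nu> ?F = \<nu>" and sets_nu [measurable_cong]: "sets \<nu> = sets td_space"
    using inv \<open>\<gamma> * lam = 1\<close> by (simp_all add: td_invariant_iff)
  interpret prob_space \<nu> by fact
  interpret N: prob_space ?N by (rule prob_space_successors)
  have s [measurable]: "s \<in> td_space \<rightarrow>\<^sub>M td_space" unfolding s_def by measurable
  have s' [measurable]: "s \<in> \<nu> \<rightarrow>\<^sub>M td_space" by measurable
  have F [measurable]: "?F \<in> \<nu> \<Otimes>\<^sub>M ?N \<rightarrow>\<^sub>M \<nu>" by measurable
  let ?\<nu> = "distr \<nu> td_space s"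
  have F' [measurable]: "?F \<in> ?\<nu> \<Otimes>\<^sub>M ?N \<rightarrow>\<^sub>M ?\<nu>" by measurable
  have "distr (?\<nu> \<Otimes>\<^sub>M ?N) ?\<nu> ?F = ?\<nu>"
  proof (rule measure_eqI)
    fix A assume "A \<in> sets (distr (?\<nu> \<Otimes>\<^sub>M ?N) ?\<nu> ?F)"
    then have A [measurable]: "A \<in> sets td_space" by simp
    have "emeasure (distr (?\<nu> \<Otimes>\<^sub>M ?N) ?\<nu> ?F) A = (\<integral>\<^sup>+ p. indicator A (?F p) \<partial>(?\<nu> \<Otimes>\<^sub>M ?N))"
      by (rule emeasure_distr_nn_integral) simp_all
    also have "\<dots> = (\<integral>\<^sup>+ X. \<integral>\<^sup>+ \<xi>. indicator A (?F (X, \<xi>)) \<partial>?N \<partial>?\<nu>)"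
      by (rule N.nn_integral_fst[symmetric]) measurable
    also have "\<dots> = (\<integral>\<^sup>+ X. \<integral>\<^sup>+ \<xi>. indicator A (?F (s X, \<xi>)) \<partial>?N \<partial>\<nu>)"
      by (rule nn_integral_distr) measurable
    \<comment> \<open>Adding c commutes with a step because the old trace enters with coefficient
      1.\<close>
    also have "\<dots> = (\<integral>\<^sup>+ X. \<integral>\<^sup>+ \<xi>. indicator A (s (?F (X, \<xi>))) \<partial>?N \<partial>\<nu>)"
      by (intro nn_integral_cong arg_cong[where f = "indicator A"])
        (auto simp: s_def td_step_def algebra_simps)
    also have "\<dots> = (\<integral>\<^sup>+ p. indicator A (s (?F p)) \<partial>(\<nu> \<Otimes>\<^sub>M ?N))"
      by (rule N.nn_integral_fst) measurable
    also have "\<dots> = (\<integral>\<^sup>+ X. indicator A (s X) \<partial>\<nu>)"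
      by (subst (2) inv'(2)[symmetric], rule nn_integral_distr[symmetric]) measurable
    also have "\<dots> = emeasure ?\<nu> A"
      by (rule emeasure_distr_nn_integral[symmetric]) simp_all
    finally show "emeasure (distr (?\<nu> \<Otimes>\<^sub>M ?N) ?\<nu> ?F) A = emeasure ?\<nu> A" .
  qed simp
  moreover have "prob_space ?\<nu>" by (rule prob_space_distr) simp
  ultimately show ?thesis
    unfolding td_invariant_iff s_def[symmetric] using \<open>\<gamma> * lam = 1\<close> by simp
qed

text \<open>If the product were 1, uniqueness would make \<nu> invariant under every translation of
  the trace. Some ball of traces carries more than half of the mass; its translate by a vector
  longer than its diameter would carry as much while being disjoint from it.\<close>

lemma unique_td_invariant_contracting:
  fixes \<phi> :: "'s::countable \<Rightarrow> real ^ 'n"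
  assumes inv: "td_invariant K \<gamma> lam \<phi> \<nu>" and unique: "\<And>\<nu>'. td_invariant K \<gamma> lam \<phi> \<nu>' \<Longrightarrow> \<nu>' = \<nu>"
  shows "\<gamma> * lam \<noteq> 1"
proof
  assume 1: "\<gamma> * lam = 1"
  have "prob_space \<nu>" and sets_nu [measurable_cong]: "sets \<nu> = sets td_space"
    using inv by (simp_all add: td_invariant_iff)
  interpret prob_space \<nu> by fact
  have sp: "space \<nu> = UNIV" using sets_eq_imp_space_eq[OF sets_nu] by (simp add: space_pair_measure)
  define B where "B R = {X :: 's \<times> 's \<times> (real ^ 'n). norm (snd (snd X)) \<le> real R}" for R
  have B [measurable]: "B R \<in> sets \<nu>" for R
  proof -
    have "{X \<in> space \<nu>. norm (snd (snd X)) \<le> real R} \<in> sets \<nu>" by measurable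
    also have "{X \<in> space \<nu>. norm (snd (snd X)) \<le> real R} = B R" by (simp add: B_def sp)
    finally show ?thesis .
  qed
  have "(\<lambda>R. measure \<nu> (B R)) \<longlonglongrightarrow> measure \<nu> (\<Union>R. B R)"
    by (rule finite_Lim_measure_incseq) (use B in \<open>auto simp: B_def incseq_def\<close>)
  moreover have "(\<Union>R. B R) = space \<nu>"
    unfolding sp B_def using real_arch_simple by auto
  ultimately have "(\<lambda>R. measure \<nu> (B R)) \<longlonglongrightarrow> 1" by (simp add: prob_space)
  then have "\<forall>\<^sub>F R in sequentially. measure \<nu> (B R) > 1 / 2"
    by (rule order_tendstoD) simp
  then obtain R where R: "measure \<nu> (B R) > 1 / 2"
    by (meson eventually_sequentially order_refl)
  obtain c :: "real ^ 'n" where c: "norm c = 2 * real R + 1"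
    using vector_choose_size[of "2 * real R + 1"] by auto
  let ?s = "\<lambda>(i, j, z). (i :: 's, j :: 's, z + c)"
  have "measure \<nu> (B R) = measure (distr \<nu> td_space ?s) (B R)"
    using unique[OF distr_td_translate_invariant[OF inv 1, of c]] by simp
  also have "\<dots> = measure \<nu> (?s -` B R \<inter> space \<nu>)"
    using B[of R] by (intro measure_distr) (simp_all add: sets_nu)
  finally have R': "measure \<nu> (?s -` B R) > 1 / 2" using R by (simp add: sp)
  have disj: "?s -` B R \<inter> B R = {}"
  proof (rule ccontr)
    assume "?s -` B R \<inter> B R \<noteq> {}"
    then obtain z where "norm z \<le> R" "norm (z + c) \<le> R" by (auto simp: B_def)
    then show False using norm_triangle_ineq4[of "z + c" z] c by simp
  qed
  have "?s -` B R \<inter> space \<nu> \<in> sets \<nu>"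
    using B[of R] by (intro measurable_sets[of ?s \<nu> td_space]) (simp_all add: sets_nu)
  then have "measure \<nu> (?s -` B R \<union> B R) = measure \<nu> (?s -` B R) + measure \<nu> (B R)"
    using disj by (intro finite_measure_Union) (simp_all add: sp)
  then show False using R R' prob_le_1[of "?s -` B R \<union> B R"] by simp
qed

lemma prob_space_eq_measure_pmf:
  fixes D :: "'s::countable measure"
  assumes "prob_space D" and sets [simp]: "sets D = UNIV"
  obtains p where "measure_pmf p = D"
proof
  interpret prob_space D by fact
  have sp [simp]: "space D = UNIV" using sets_eq_imp_space_eq[of D "count_space UNIV"] by simp
  have "(\<integral>\<^sup>+ x. ennreal (measure D {x}) \<partial>count_space UNIV) = emeasure D UNIV"
    using emeasure_countable_singleton[of UNIV D] by (simp add: emeasure_eq_measure)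
  then have "pmf (embed_pmf (\<lambda>x. measure D {x})) x = measure D {x}" for x
    using emeasure_space_1 by (intro pmf_embed_pmf) simp_all
  then show "measure_pmf (embed_pmf (\<lambda>x. measure D {x})) = D"
    by (intro measure_eqI_countable[of _ UNIV]) (simp_all add: emeasure_pmf_single emeasure_eq_measure)
qed

section \<open>Marginals of the invariant law\<close>

locale td_invariant_law =
  fixes K :: "'s::countable \<Rightarrow> 's pmf" and \<pi> :: "'s pmf" and \<gamma> lam :: real
    and \<phi> :: "'s \<Rightarrow> real ^ 'n" and \<nu> :: "('s \<times> 's \<times> (real ^ 'n)) measure"
  assumes gamma: "0 < \<gamma>" "\<gamma> \<le> 1" and lambda: "0 \<le> lam" "lam \<le> 1"
    and pi_unique: "\<And>\<pi>'. stationary K \<pi>' \<Longrightarrow> \<pi>' = \<pi>"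
    and basis_L2: "\<And>i. integrable (measure_pmf \<pi>) (\<lambda>s. (\<phi> s $ i)\<^sup>2)"
    and nu_invariant: "td_invariant K \<gamma> lam \<phi> \<nu>"
    and nu_unique: "\<And>\<nu>'. td_invariant K \<gamma> lam \<phi> \<nu>' \<Longrightarrow> \<nu>' = \<nu>"
begin

definition \<beta> where "\<beta> = \<gamma> * lam"

lemma beta: "0 \<le> \<beta>" "\<beta> < 1"
proof -
  show "0 \<le> \<beta>" using gamma lambda by (simp add: \<beta>_def)
  have "\<beta> \<le> 1 * 1" unfolding \<beta>_def using gamma lambda by (intro mult_mono) auto
  moreover have "\<beta> \<noteq> 1" unfolding \<beta>_def
    by (rule unique_td_invariant_contracting[OF nu_invariant nu_unique])
  ultimately show "\<beta> < 1" by simp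
qed

lemma prob_space_nu: "prob_space \<nu>" and sets_nu [measurable_cong]: "sets \<nu> = sets td_space"
  using nu_invariant by (simp_all add: td_invariant_iff)

sublocale random_iteration \<nu> "successors K" "td_step \<beta> \<phi>"
proof (intro random_iteration.intro random_iteration_axioms.intro)
  show "prob_space \<nu>" by (rule prob_space_nu)
  show "prob_space (successors K)" by (rule prob_space_successors)
  show "td_step \<beta> \<phi> \<in> \<nu> \<Otimes>\<^sub>M successors K \<rightarrow>\<^sub>M \<nu>" by measurable
  show "distr (\<nu> \<Otimes>\<^sub>M successors K) \<nu> (td_step \<beta> \<phi>) = \<nu>"
    using nu_invariant by (simp add: td_invariant_iff \<beta>_def)
  fix \<nu>' assume *: "prob_space \<nu>'" "sets \<nu>' = sets \<nu>"
    and "distr (\<nu>' \<Otimes>\<^sub>M successors K) \<nu> (td_step \<beta> \<phi>) = \<nu>'"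
  moreover have "distr (\<nu>' \<Otimes>\<^sub>M successors K) \<nu> (td_step \<beta> \<phi>)
      = distr (\<nu>' \<Otimes>\<^sub>M successors K) \<nu>' (td_step \<beta> \<phi>)"
    by (rule distr_cong) (simp_all add: *)
  ultimately show "\<nu>' = \<nu>"
    by (intro nu_unique) (simp add: td_invariant_iff sets_nu \<beta>_def)
qed

lemma space_nu: "space \<nu> = UNIV"
  using sets_eq_imp_space_eq[OF sets_nu] by (simp add: space_pair_measure)

lemma emeasure_nu_step:
  assumes "B \<in> sets td_space"
  shows "emeasure \<nu> B =
    (\<integral>\<^sup>+ X. emeasure (measure_pmf (K (fst (snd X))))
       {k. (fst (snd X), k, \<beta> *\<^sub>R snd (snd X) + \<phi> (fst (snd X))) \<in> B} \<partial>\<nu>)"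
proof -
  have "emeasure \<nu> B = (\<integral>\<^sup>+ (i, j, z). emeasure (measure_pmf (K j)) {k. (j, k, \<beta> *\<^sub>R z + \<phi> j) \<in> B} \<partial>\<nu>)"
    using nu_invariant assms by (simp add: td_invariant_def \<beta>_def sets_nu)
  also have "\<dots> = (\<integral>\<^sup>+ X. emeasure (measure_pmf (K (fst (snd X))))
       {k. (fst (snd X), k, \<beta> *\<^sub>R snd (snd X) + \<phi> (fst (snd X))) \<in> B} \<partial>\<nu>)"
    by (intro nn_integral_cong) auto
  finally show ?thesis .
qed

text \<open>Apart from the freshly drawn successor, a step yields
  \<open>(j, \<beta> z + \<phi> j)\<close>, a function of the old triple. By stationarity this pair
  is distributed as the current state and trace, the form in which invariance enters the moment
  computations.\<close>

lemma distr_state_trace: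
  "distr \<nu> (count_space UNIV \<Otimes>\<^sub>M borel) (\<lambda>X. (fst (snd X), \<beta> *\<^sub>R snd (snd X) + \<phi> (fst (snd X))))
     = distr \<nu> (count_space UNIV \<Otimes>\<^sub>M borel) (\<lambda>X. (fst X, snd (snd X)))" (is "?D1 = ?D2")
proof (rule measure_eqI)
  fix A assume "A \<in> sets ?D1"
  then have A [measurable]: "A \<in> sets (count_space UNIV \<Otimes>\<^sub>M borel)" by simp
  have "{X \<in> space (td_space :: ('s \<times> 's \<times> (real ^ 'n)) measure). (fst X, snd (snd X)) \<in> A} \<in> sets td_space"
    by measurable
  then have B: "{X. (fst X, snd (snd X)) \<in> A} \<in> sets (td_space :: ('s \<times> 's \<times> (real ^ 'n)) measure)"
    by (simp add: space_pair_measure)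
  have "emeasure ?D2 A = emeasure \<nu> {X. (fst X, snd (snd X)) \<in> A}"
    by (subst emeasure_distr) (simp_all add: space_nu vimage_def)
  also have "\<dots> = (\<integral>\<^sup>+ X. indicator A (fst (snd X), \<beta> *\<^sub>R snd (snd X) + \<phi> (fst (snd X))) \<partial>\<nu>)"
    unfolding emeasure_nu_step[OF B] by (intro nn_integral_cong) (simp add: indicator_def)
  also have "\<dots> = emeasure ?D1 A"
    by (rule emeasure_distr_nn_integral[symmetric]) measurable
  finally show "emeasure ?D1 A = emeasure ?D2 A" ..
qed simp

lemma integral_state_trace:
  fixes g :: "'s \<Rightarrow> real ^ 'n \<Rightarrow> real"
  assumes "case_prod g \<in> borel_measurable (count_space UNIV \<Otimes>\<^sub>M borel)"
  shows "(LINT X|\<nu>. g (fst (snd X)) (\<beta> *\<^sub>R snd (snd X) + \<phi> (fst (snd X)))) = (LINT X|\<nu>. g (fst X) (snd (snd X)))"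
  using integral_distr[OF _ assms, of "\<lambda>X. (fst (snd X), \<beta> *\<^sub>R snd (snd X) + \<phi> (fst (snd X)))" \<nu>]
    integral_distr[OF _ assms, of "\<lambda>X. (fst X, snd (snd X))" \<nu>]
  by (simp add: distr_state_trace)

lemma distr_next_state: "distr \<nu> (count_space UNIV) (\<lambda>X. fst (snd X)) = distr \<nu> (count_space UNIV) fst"
proof -
  have "distr \<nu> (count_space UNIV) (\<lambda>X. fst (snd X))
      = distr (distr \<nu> (count_space UNIV \<Otimes>\<^sub>M borel)
          (\<lambda>X. (fst (snd X), \<beta> *\<^sub>R snd (snd X) + \<phi> (fst (snd X))))) (count_space UNIV) fst"
    by (subst distr_distr) (simp_all add: comp_def)
  also have "\<dots> = distr \<nu> (count_space UNIV) fst"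
    unfolding distr_state_trace by (subst distr_distr) (simp_all add: comp_def)
  finally show ?thesis .
qed

text \<open>The marginal is a stationary law of \<open>K\<close>, which \<open>pi_unique\<close>
  identifies as \<pi>.\<close>

lemma distr_state: "distr \<nu> (count_space UNIV) fst = measure_pmf \<pi>"
proof -
  have "prob_space (distr \<nu> (count_space UNIV) fst)"
    by (rule inv.prob_space_distr) measurable
  then obtain p where p: "measure_pmf p = distr \<nu> (count_space UNIV) fst"
    by (rule prob_space_eq_measure_pmf) auto
  have "stationary K p"
    unfolding stationary_def
  proof (rule pmf_eqI)
    fix b
    have B': "{X. fst (snd X) = b} \<in> sets (td_space :: ('s \<times> 's \<times> (real ^ 'n)) measure)"
    proof -
      have "{X \<in> space (td_space :: ('s \<times> 's \<times> (real ^ 'n)) measure). fst (snd X) = b} \<in> sets td_space"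
        by measurable
      then show ?thesis by (simp add: space_pair_measure)
    qed
    \<comment> \<open>The first and second states have the same law \<open>p\<close>, and averaging
      \<open>K\<close> over the second state gives the law of the second state one step
      later.\<close>
    have "ennreal (pmf (bind_pmf p K) b) = (\<integral>\<^sup>+ a. pmf (K a) b \<partial>distr \<nu> (count_space UNIV) (\<lambda>X. fst (snd X)))"
      by (simp add: ennreal_pmf_bind p distr_next_state)
    also have "\<dots> = (\<integral>\<^sup>+ X. pmf (K (fst (snd X))) b \<partial>\<nu>)"
      by (rule nn_integral_distr) measurable
    also have "\<dots> = emeasure \<nu> {X. fst (snd X) = b}"
      unfolding emeasure_nu_step[OF B'] by (simp add: emeasure_pmf_single)
    also have "\<dots> = emeasure (distr \<nu> (count_space UNIV) (\<lambda>X. fst (snd X))) {b}"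
      by (subst emeasure_distr) (simp_all add: space_nu vimage_def)
    also have "\<dots> = ennreal (pmf p b)"
      by (simp add: distr_next_state emeasure_pmf_single flip: p)
    finally show "pmf (bind_pmf p K) b = pmf p b" by simp
  qed
  then show ?thesis using pi_unique p by metis
qed

lemma pmf_transition_law: "pmf (transition_law K \<pi>) (a, b) = pmf \<pi> a * pmf (K a) b"
proof -
  have "ennreal (pmf (transition_law K \<pi>) (a, b)) = (\<integral>\<^sup>+ x. ennreal (pmf (K a) b) * indicator {a} x \<partial>measure_pmf \<pi>)"
    unfolding transition_law_def ennreal_pmf_bind
  proof (intro nn_integral_cong)
    fix x
    show "ennreal (pmf (map_pmf (Pair x) (K x)) (a, b)) = ennreal (pmf (K a) b) * indicator {a} x"
    proof (cases "x = a")
      case True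
      have "pmf (map_pmf (Pair a) (K a)) (Pair a b) = pmf (K a) b"
        by (rule pmf_map_inj') (simp add: inj_def)
      then show ?thesis using True by simp
    next
      case False
      then have "pmf (map_pmf (Pair x) (K x)) (a, b) = 0"
        by (subst pmf_eq_0_set_pmf) auto
      then show ?thesis using False by simp
    qed
  qed
  also have "\<dots> = ennreal (pmf \<pi> a * pmf (K a) b)"
    by (simp add: nn_integral_cmult emeasure_pmf_single ennreal_mult' mult.commute)
  finally show ?thesis by simp
qed

text \<open>After a step the current state is the former next state, of law \<pi>, and its successor
  is drawn from \<open>K\<close>.\<close>

lemma emeasure_nu_transition:
  "emeasure \<nu> {X. fst X = a \<and> fst (snd X) = b} = ennreal (pmf \<pi> a * pmf (K a) b)"
proof -
  have "{X \<in> space (td_space :: ('s \<times> 's \<times> (real ^ 'n)) measure). fst X = a \<and> fst (snd X) = b} \<in> sets td_space"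
    by measurable
  then have B: "{X. fst X = a \<and> fst (snd X) = b} \<in> sets (td_space :: ('s \<times> 's \<times> (real ^ 'n)) measure)"
    by (simp add: space_pair_measure)
  have "emeasure \<nu> {X. fst X = a \<and> fst (snd X) = b}
      = (\<integral>\<^sup>+ X. ennreal (pmf (K a) b) * indicator {a} (fst (snd X)) \<partial>\<nu>)"
    unfolding emeasure_nu_step[OF B]
  proof (intro nn_integral_cong)
    fix X :: "'s \<times> 's \<times> (real ^ 'n)"
    show "emeasure (measure_pmf (K (fst (snd X)))) {k. (fst (snd X), k, \<beta> *\<^sub>R snd (snd X) + \<phi> (fst (snd X)))
        \<in> {X. fst X = a \<and> fst (snd X) = b}} = ennreal (pmf (K a) b) * indicator {a} (fst (snd X))"
      by (cases "fst (snd X) = a") (simp_all add: emeasure_pmf_single)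
  qed
  also have "\<dots> = (\<integral>\<^sup>+ x. ennreal (pmf (K a) b) * indicator {a} x \<partial>distr \<nu> (count_space UNIV) (\<lambda>X. fst (snd X)))"
    by (rule nn_integral_distr[symmetric]) simp_all
  also have "\<dots> = ennreal (pmf \<pi> a * pmf (K a) b)"
    by (simp add: distr_next_state distr_state nn_integral_cmult emeasure_pmf_single ennreal_mult' mult.commute)
  finally show ?thesis .
qed

lemma measurable_transition [measurable]: "(\<lambda>X. (fst X, fst (snd X))) \<in> \<nu> \<rightarrow>\<^sub>M count_space UNIV"
proof -
  have "(\<lambda>X. (fst X, fst (snd X))) \<in> \<nu> \<rightarrow>\<^sub>M count_space UNIV \<Otimes>\<^sub>M count_space UNIV"
    by measurable
  then show ?thesis by (simp add: pair_measure_countable)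
qed

lemma distr_transition:
  "distr \<nu> (count_space UNIV) (\<lambda>X. (fst X, fst (snd X))) = measure_pmf (transition_law K \<pi>)" (is "?D = _")
proof (rule measure_eqI_countable[of _ UNIV])
  fix ab :: "'s \<times> 's" 
  obtain a b where ab: "ab = (a, b)" by (cases ab)
  have "emeasure ?D {ab} = emeasure \<nu> {X. fst X = a \<and> fst (snd X) = b}"
    by (subst emeasure_distr[OF measurable_transition]) (simp_all add: space_nu vimage_def ab)
  then show "emeasure ?D {ab} = emeasure (measure_pmf (transition_law K \<pi>)) {ab}"
    by (simp add: ab emeasure_nu_transition emeasure_pmf_single pmf_transition_law)
qed simp_all

lemma integrable_nu_transition:
  "integrable \<nu> (\<lambda>X. g (fst X) (fst (snd X)) :: real) \<longleftrightarrow>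
   integrable (measure_pmf (transition_law K \<pi>)) (\<lambda>p. g (fst p) (snd p))"
  using integrable_distr_eq[OF measurable_transition, of "\<lambda>p. g (fst p) (snd p)"]
  by (simp add: distr_transition)

lemma integrable_nu_state:
  assumes "integrable (measure_pmf \<pi>) (g :: 's \<Rightarrow> real)"
  shows "integrable \<nu> (\<lambda>X. g (fst X))" "integrable \<nu> (\<lambda>X. g (fst (snd X)))"
proof -
  show "integrable \<nu> (\<lambda>X. g (fst X))"
    by (rule integrable_distr[where M' = "count_space UNIV"]) (simp_all add: assms distr_state)
  show "integrable \<nu> (\<lambda>X. g (fst (snd X)))"
    by (rule integrable_distr[where M' = "count_space UNIV"]) (simp_all add: assms distr_next_state distr_state)
qed

end

section \<open>Second moments under the invariant law\<close>

lemma integrable_mult_square_integrable: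
  fixes f g :: "'a \<Rightarrow> real"
  assumes [measurable]: "f \<in> borel_measurable M" "g \<in> borel_measurable M"
    and "integrable M (\<lambda>x. (f x)\<^sup>2)" "integrable M (\<lambda>x. (g x)\<^sup>2)"
  shows "integrable M (\<lambda>x. f x * g x)"
proof (rule Bochner_Integration.integrable_bound)
  show "integrable M (\<lambda>x. (f x)\<^sup>2 + (g x)\<^sup>2)" using assms by simp
  show "AE x in M. norm (f x * g x) \<le> norm ((f x)\<^sup>2 + (g x)\<^sup>2)"
  proof (intro AE_I2)
    fix x
    have "2 * \<bar>f x * g x\<bar> \<le> (f x)\<^sup>2 + (g x)\<^sup>2"
      using zero_le_power2[of "\<bar>f x\<bar> - \<bar>g x\<bar>"] by (simp add: power2_diff abs_mult)
    then show "norm (f x * g x) \<le> norm ((f x)\<^sup>2 + (g x)\<^sup>2)" by simp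
  qed
qed simp

lemma integrable_inner_square:
  fixes g :: "'a \<Rightarrow> real ^ 'n"
  assumes "\<And>a. integrable M (\<lambda>x. (g x $ a)\<^sup>2)" and [measurable]: "g \<in> borel_measurable M"
  shows "integrable M (\<lambda>x. (v \<bullet> g x)\<^sup>2)"
proof -
  have "(\<lambda>x. (v \<bullet> g x)\<^sup>2) = (\<lambda>x. \<Sum>a\<in>UNIV. \<Sum>b\<in>UNIV. v $ a * v $ b * (g x $ a * g x $ b))"
    by (simp add: inner_vec_def power2_eq_square sum_product ac_simps)
  moreover have "integrable M (\<lambda>x. g x $ a * g x $ b)" for a b
    using assms by (intro integrable_mult_square_integrable) simp_all
  ultimately show ?thesis by simp
qed

text \<open>Monotone convergence: the truncations, set to 0 where \<open>u\<close> exceeds n,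
  increase to \<open>u\<close>, and the bound \<open>C\<close> on their integrals is uniform in
  n.\<close>

lemma integrable_of_truncations:
  fixes u :: "'a \<Rightarrow> real"
  assumes [measurable]: "u \<in> borel_measurable M" and nonneg: "\<And>x. 0 \<le> u x"
    and int: "\<And>n::nat. integrable M (\<lambda>x. u x * indicator {x. u x \<le> n} x)"
    and le: "\<And>n::nat. (LINT x|M. u x * indicator {x. u x \<le> n} x) \<le> C"
  shows "integrable M u"
proof -
  let ?f = "\<lambda>(n::nat) x. u x * indicator {x. u x \<le> n} x"
  have mono: "mono (\<lambda>n. ?f n x)" for x
    by (rule monoI) (auto simp: indicator_def nonneg)
  have lim: "(\<lambda>n. ?f n x) \<longlonglongrightarrow> u x" for x
  proof (rule tendsto_eventually)
    obtain N :: nat where "u x \<le> N" using real_arch_simple by blast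
    then show "\<forall>\<^sub>F n in sequentially. ?f n x = u x"
      unfolding eventually_sequentially by (intro exI[of _ N]) (auto simp: indicator_def)
  qed
  have "incseq (\<lambda>n. LINT x|M. ?f n x)"
  proof (intro incseq_SucI integral_mono int)
    show "?f n x \<le> ?f (Suc n) x" for n x
      using monoD[OF mono[of x], of n "Suc n"] by simp
  qed
  then obtain L where L: "(\<lambda>n. LINT x|M. ?f n x) \<longlonglongrightarrow> L"
    by (rule incseq_convergent[where B = C]) (use le in blast)
  show ?thesis
    by (rule integrable_monotone_convergence[OF int _ _ L]) (simp_all only: mono lim AE_I2 assms(1))
qed

context td_invariant_law
begin

lemma integrable_basis: "integrable \<nu> (\<lambda>X. (\<phi> (fst X) $ a)\<^sup>2)" "integrable \<nu> (\<lambda>X. (\<phi> (fst (snd X)) $ a)\<^sup>2)"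
  using integrable_nu_state[OF basis_L2[of a]] by simp_all

text \<open>With \<open>u t = min t n\<close>, invariance and \<open>(\<beta> z + f)\<^sup>2 \<le> \<beta> z\<^sup>2 + f\<^sup>2 / (1 - \<beta>)\<close> bound
  \<open>E[u(z\<^sup>2) - u(\<beta> z\<^sup>2)]\<close> uniformly in the truncation level.\<close>

lemma integrable_trace: "integrable \<nu> (\<lambda>X. (snd (snd X) $ a)\<^sup>2)"
proof (rule integrable_of_truncations)
  let ?y = "\<lambda>X :: 's \<times> 's \<times> (real ^ 'n). (snd (snd X) $ a)\<^sup>2" and ?f = "\<lambda>X :: 's \<times> 's \<times> (real ^ 'n). (\<phi> (fst (snd X)) $ a)\<^sup>2 / (1 - \<beta>)"
  let ?C = "LINT X|\<nu>. ?f X"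
  have if': "integrable \<nu> ?f" using integrable_basis by simp
  fix n :: nat
  let ?m = "\<lambda>t. min t (real n)"
  show int: "integrable \<nu> (\<lambda>X. ?y X * indicator {X. ?y X \<le> n} X)"
    by (rule inv.integrable_const_bound[where B = "real n"]) (auto simp: indicator_def)
  have mb: "integrable \<nu> (\<lambda>X. ?m (u X))" if [measurable]: "u \<in> borel_measurable \<nu>" and "\<And>X. 0 \<le> u X" for u
    by (rule inv.integrable_const_bound[where B = "real n"]) (use that in auto)
  have i1: "integrable \<nu> (\<lambda>X. ?m (?y X))" by (rule mb) simp_all
  have i2: "integrable \<nu> (\<lambda>X. ?m (\<beta> * ?y X))" by (rule mb) (simp_all add: beta)
  have i3: "integrable \<nu> (\<lambda>X. ?m ((\<beta> * snd (snd X) $ a + \<phi> (fst (snd X)) $ a)\<^sup>2))"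
    by (rule mb) simp_all
  \<comment> \<open>Convexity of the square: \<beta> z + f is the mean of z and f / (1 - \<beta>)
    with weights \<beta> and 1 - \<beta>.\<close>
  have conv: "(\<beta> * z + f)\<^sup>2 \<le> \<beta> * z\<^sup>2 + f\<^sup>2 / (1 - \<beta>)" for z f :: real
  proof -
    have "(1 - \<beta>) * (\<beta> * z\<^sup>2 + f\<^sup>2 / (1 - \<beta>) - (\<beta> * z + f)\<^sup>2) = \<beta> * ((1 - \<beta>) * z - f)\<^sup>2"
      using beta by (simp add: field_simps power2_eq_square)
    also have "\<dots> \<ge> 0" using beta by simp
    finally show ?thesis using beta by (simp add: zero_le_mult_iff)
  qed
  have "(\<lambda>(i, z). ?m ((z $ a)\<^sup>2)) \<in> borel_measurable (count_space UNIV \<Otimes>\<^sub>M borel)"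
    by measurable
  from integral_state_trace[OF this]
  have "(LINT X|\<nu>. ?m (?y X)) = (LINT X|\<nu>. ?m ((\<beta> * snd (snd X) $ a + \<phi> (fst (snd X)) $ a)\<^sup>2))"
    by simp
  also have "\<dots> \<le> (LINT X|\<nu>. ?m (\<beta> * ?y X) + ?f X)"
  proof (rule integral_mono)
    fix X
    have "0 \<le> ?f X" using beta by simp
    then show "?m ((\<beta> * snd (snd X) $ a + \<phi> (fst (snd X)) $ a)\<^sup>2) \<le> ?m (\<beta> * ?y X) + ?f X"
      using conv[of "snd (snd X) $ a" "\<phi> (fst (snd X)) $ a"] by linarith
  qed (use i2 i3 if' in simp_all)
  also have "\<dots> = (LINT X|\<nu>. ?m (\<beta> * ?y X)) + ?C"
    using i2 if' by (rule Bochner_Integration.integral_add)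
  finally have "(LINT X|\<nu>. ?m (?y X) - ?m (\<beta> * ?y X)) \<le> ?C"
    using i1 i2 by simp
  \<comment> \<open>Where \<open>?y X \<le> n\<close>, neither minimum truncates and the difference
    is 1 - \<beta> times \<open>?y X\<close>; elsewhere it is nonnegative.\<close>
  moreover have "(LINT X|\<nu>. (1 - \<beta>) * (?y X * indicator {X. ?y X \<le> n} X)) \<le> (LINT X|\<nu>. ?m (?y X) - ?m (\<beta> * ?y X))"
  proof (rule integral_mono)
    fix X
    have le: "\<beta> * ?y X \<le> ?y X" using beta by (intro mult_left_le_one_le) simp_all
    show "(1 - \<beta>) * (?y X * indicator {X. ?y X \<le> n} X) \<le> ?m (?y X) - ?m (\<beta> * ?y X)"
    proof (cases "?y X \<le> n")
      case True
      then have "?m (?y X) = ?y X" "?m (\<beta> * ?y X) = \<beta> * ?y X" using le by linarith+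
      then show ?thesis using True by (simp add: left_diff_distrib)
    next
      case False
      moreover have "?m (\<beta> * ?y X) \<le> ?m (?y X)" using le by linarith
      ultimately show ?thesis by simp
    qed
  qed (use int i1 i2 in simp_all)
  moreover have "(LINT X|\<nu>. (1 - \<beta>) * (?y X * indicator {X. ?y X \<le> n} X))
      = (1 - \<beta>) * (LINT X|\<nu>. ?y X * indicator {X. ?y X \<le> n} X)"
    by (rule integral_mult_right_zero)
  ultimately have "(1 - \<beta>) * (LINT X|\<nu>. ?y X * indicator {X. ?y X \<le> n} X) \<le> ?C"
    by linarith
  then show "(LINT X|\<nu>. ?y X * indicator {X. ?y X \<le> n} X) \<le> ?C / (1 - \<beta>)"
    using beta by (subst pos_le_divide_eq) (simp_all only: mult.commute diff_gt_0_iff_gt)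
qed simp_all

lemma integrable_trace_product:
  assumes [measurable]: "g \<in> borel_measurable \<nu>" and "integrable \<nu> (\<lambda>X. (g X)\<^sup>2)"
  shows "integrable \<nu> (\<lambda>X. snd (snd X) $ a * g X)"
  by (rule integrable_mult_square_integrable[OF _ _ integrable_trace assms(2)]) simp_all

lemma integrable_square_feature_diff:
  "integrable \<nu> (\<lambda>X. (feature_diff \<gamma> \<phi> (fst X) (fst (snd X)) $ b)\<^sup>2)"
proof -
  have "integrable \<nu> (\<lambda>X. \<phi> (fst X) $ b * \<phi> (fst (snd X)) $ b)"
    using integrable_basis by (intro integrable_mult_square_integrable) simp_all
  then have "integrable \<nu> (\<lambda>X. (\<phi> (fst X) $ b)\<^sup>2 + \<gamma>\<^sup>2 * (\<phi> (fst (snd X)) $ b)\<^sup>2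
      - 2 * \<gamma> * (\<phi> (fst X) $ b * \<phi> (fst (snd X)) $ b))"
    using integrable_basis by simp
  then show ?thesis
    by (simp add: feature_diff_def power2_diff power_mult_distrib ac_simps)
qed

text \<open>With \<open>Y = v \<bullet> z\<close> and \<open>f = v \<bullet> \<phi>\<close>, stationarity of \<open>Y\<^sub>t\<^sub>+\<^sub>1 = \<beta> Y\<^sub>t + f(x\<^sub>t\<^sub>+\<^sub>1)\<close> turns the quadratic
  form into \<open>E[f\<^sup>2] - \<gamma> (1 - lam) E[Y f(x\<^sub>t\<^sub>+\<^sub>1)]\<close>, and \<open>E[(Y - f(x\<^sub>t\<^sub>+\<^sub>1) / (1 - \<beta>))\<^sup>2] \<ge> 0\<close> bounds the
  last expectation by \<open>E[f\<^sup>2] / (1 - \<beta>)\<close>.\<close>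

lemma quadratic_form_pos:
  assumes "\<gamma> < 1" and pos: "0 < (LINT s|measure_pmf \<pi>. (v \<bullet> \<phi> s)\<^sup>2)"
  shows "0 < (LINT X|\<nu>. (v \<bullet> snd (snd X)) * (v \<bullet> feature_diff \<gamma> \<phi> (fst X) (fst (snd X))))"
proof -
  let ?Y = "\<lambda>X :: 's \<times> 's \<times> (real ^ 'n). v \<bullet> snd (snd X)"
  let ?f0 = "\<lambda>X :: 's \<times> 's \<times> (real ^ 'n). v \<bullet> \<phi> (fst X)"
  let ?f1 = "\<lambda>X :: 's \<times> 's \<times> (real ^ 'n). v \<bullet> \<phi> (fst (snd X))"
  have Y2: "integrable \<nu> (\<lambda>X. (?Y X)\<^sup>2)" by (rule integrable_inner_square[OF integrable_trace]) simp
  have f02: "integrable \<nu> (\<lambda>X. (?f0 X)\<^sup>2)" by (rule integrable_inner_square[OF integrable_basis(1)]) simp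
  have f12: "integrable \<nu> (\<lambda>X. (?f1 X)\<^sup>2)" by (rule integrable_inner_square[OF integrable_basis(2)]) simp
  have Yf0: "integrable \<nu> (\<lambda>X. ?Y X * ?f0 X)" by (rule integrable_mult_square_integrable[OF _ _ Y2 f02]) simp_all
  have Yf1: "integrable \<nu> (\<lambda>X. ?Y X * ?f1 X)" by (rule integrable_mult_square_integrable[OF _ _ Y2 f12]) simp_all
  define y p N where "y = (LINT X|\<nu>. (?Y X)\<^sup>2)" and "p = (LINT X|\<nu>. ?Y X * ?f1 X)"
    and "N = (LINT X|\<nu>. (?f1 X)\<^sup>2)"
  have "N = (LINT s|distr \<nu> (count_space UNIV) (\<lambda>X. fst (snd X)). (v \<bullet> \<phi> s)\<^sup>2)"
    unfolding N_def by (rule integral_distr[symmetric]) simp_all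
  then have N: "0 < N" using pos by (simp add: distr_next_state distr_state)
  have "y = (LINT X|\<nu>. (\<beta> * ?Y X + ?f1 X)\<^sup>2)"
    unfolding y_def using integral_state_trace[of "\<lambda>i z. (v \<bullet> z)\<^sup>2"] by (simp add: inner_add_right)
  also have "\<dots> = (LINT X|\<nu>. \<beta>\<^sup>2 * (?Y X)\<^sup>2 + 2 * \<beta> * (?Y X * ?f1 X) + (?f1 X)\<^sup>2)"
    by (simp add: power2_sum power_mult_distrib ac_simps)
  also have "\<dots> = \<beta>\<^sup>2 * y + 2 * \<beta> * p + N"
    using Y2 f12 Yf1 by (simp add: y_def p_def N_def)
  finally have y: "(1 - \<beta>\<^sup>2) * y = 2 * \<beta> * p + N" by (simp add: algebra_simps)
  have "(LINT X|\<nu>. ?Y X * ?f0 X) = (LINT X|\<nu>. (\<beta> * ?Y X + ?f1 X) * ?f1 X)"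
    using integral_state_trace[of "\<lambda>i z. (v \<bullet> z) * (v \<bullet> \<phi> i)"] by (simp add: inner_add_right)
  also have "\<dots> = (LINT X|\<nu>. \<beta> * (?Y X * ?f1 X) + (?f1 X)\<^sup>2)"
    by (simp add: algebra_simps power2_eq_square)
  also have "\<dots> = \<beta> * p + N" using f12 Yf1 by (simp add: p_def N_def)
  finally have p: "(LINT X|\<nu>. ?Y X * ?f0 X) = \<beta> * p + N" .
  define s where "s = 1 / (1 - \<beta>)"
  have s: "s > 0" "s * (1 - \<beta>) = 1" using beta by (simp_all add: s_def)
  have "0 \<le> (LINT X|\<nu>. (?Y X - s * ?f1 X)\<^sup>2)" by simp
  also have "\<dots> = (LINT X|\<nu>. (?Y X)\<^sup>2 - 2 * s * (?Y X * ?f1 X) + s\<^sup>2 * (?f1 X)\<^sup>2)"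
    by (intro Bochner_Integration.integral_cong refl) (simp add: power2_diff power_mult_distrib)
  also have "\<dots> = y - 2 * s * p + s\<^sup>2 * N"
    using Y2 f12 Yf1 by (simp add: y_def p_def N_def)
  \<comment> \<open>The factor 1 - \<beta>^2 lets the stationarity identity for the second moment
    eliminate \<open>y\<close>.\<close>
  finally have "0 \<le> (1 - \<beta>\<^sup>2) * (y - 2 * s * p + s\<^sup>2 * N)"
    using beta by (simp add: power_le_one abs_square_le_1)
  also have "\<dots> = 2 * \<beta> * p + N - 2 * (1 + \<beta>) * (s * (1 - \<beta>)) * p + (1 + \<beta>) * s * (s * (1 - \<beta>)) * N"
    unfolding distrib_left right_diff_distrib y by (simp add: algebra_simps power2_eq_square)
  also have "\<dots> = 2 * (N * s - p) + N * (1 + \<beta> * s - s)"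
    unfolding s(2) by (simp add: algebra_simps)
  also have "1 + \<beta> * s - s = 0" using s(2) by (simp add: algebra_simps)
  finally have ple: "p \<le> N * s" by simp
  have "(LINT X|\<nu>. ?Y X * (v \<bullet> feature_diff \<gamma> \<phi> (fst X) (fst (snd X))))
      = (LINT X|\<nu>. ?Y X * ?f0 X - \<gamma> * (?Y X * ?f1 X))"
    by (simp add: feature_diff_def inner_diff_right algebra_simps)
  also have "\<dots> = N - \<gamma> * (1 - lam) * p"
    using Yf0 Yf1 p by (simp add: p_def \<beta>_def algebra_simps)
  finally have eq: "(LINT X|\<nu>. ?Y X * (v \<bullet> feature_diff \<gamma> \<phi> (fst X) (fst (snd X))))
      = N - \<gamma> * (1 - lam) * p" .
  \<comment> \<open>Since N = N s (1 - \<beta>), the bound p \<le> N s makes the form at least N s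
    (1 - \<gamma>); this is where \<gamma> < 1 enters.\<close>
  have "0 < N * s * (1 - \<gamma>)" using N s(1) \<open>\<gamma> < 1\<close> by simp
  also have "\<dots> = N * s * (1 - \<beta>) - \<gamma> * (1 - lam) * (N * s)"
    by (simp add: \<beta>_def algebra_simps)
  also have "N * s * (1 - \<beta>) = N" using s(2) by (simp only: mult.assoc mult_1_right)
  also have "N - \<gamma> * (1 - lam) * (N * s) \<le> N - \<gamma> * (1 - lam) * p"
    using ple gamma lambda by (simp add: mult_left_mono)
  finally show ?thesis unfolding eq .
qed

end

section \<open>Averages along trajectories\<close>

text \<open>Each term over n + 1 is a combination of two consecutive averages, so \<open>u\<close>
  grows at most linearly. The discounted series then converges absolutely by comparison with the
  derivative of the geometric series, and its partial sums divided by n vanish.\<close>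

lemma discounted_average_tendsto_0:
  fixes u :: "nat \<Rightarrow> real"
  assumes avg: "(\<lambda>n. (\<Sum>t<n. u t) / n) \<longlonglongrightarrow> L" and b: "0 \<le> b" "b < 1"
  shows "(\<lambda>n. (\<Sum>t<n. b ^ t * u t) / n) \<longlonglongrightarrow> 0"
proof -
  let ?a = "\<lambda>n. (\<Sum>t<n. u t) / n"
  have "u n / Suc n = ?a (Suc n) - ?a n * (n / Suc n)" for n
  proof -
    have "?a n * (n / Suc n) = (\<Sum>t<n. u t) / Suc n" by (cases "n = 0") simp_all
    then show ?thesis by (simp add: add_divide_distrib)
  qed
  moreover have "(\<lambda>n. ?a (Suc n) - ?a n * (n / Suc n)) \<longlonglongrightarrow> L - L * 1"
    by (intro tendsto_intros LIMSEQ_Suc[OF avg] avg LIMSEQ_n_over_Suc_n)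
  ultimately have "(\<lambda>n. u n / Suc n) \<longlonglongrightarrow> 0" by simp
  then have "Bseq (\<lambda>n. u n / Suc n)" using convergent_imp_Bseq convergent_def by blast
  then obtain C where "\<And>n. norm (u n / Suc n) \<le> C" by (elim BseqE) blast
  then have C: "\<bar>u n\<bar> \<le> C * Suc n" for n by (simp add: field_simps)
  have "summable (\<lambda>n. C * (Suc n * b ^ n))"
    using geometric_deriv_sums[of b] b by (intro summable_mult) (auto simp: sums_iff)
  then have "summable (\<lambda>n. b ^ n * u n)"
  proof (rule summable_comparison_test[rotated], intro exI allI impI)
    fix n
    have "b ^ n * \<bar>u n\<bar> \<le> b ^ n * (C * Suc n)" using C b by (intro mult_left_mono) simp_all
    then show "norm (b ^ n * u n) \<le> C * (Suc n * b ^ n)" using b by (simp add: abs_mult ac_simps)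
  qed
  then have "(\<lambda>n. (\<Sum>t<n. b ^ t * u t) * (1 / real n)) \<longlonglongrightarrow> (\<Sum>t. b ^ t * u t) * 0"
    by (intro tendsto_mult summable_LIMSEQ lim_1_over_n)
  then show ?thesis by simp
qed

text \<open>Tolerances 1 / (j + 1) reduce convergence to countably many quantifiers.\<close>

lemma pred_LIMSEQ:
  fixes f :: "nat \<Rightarrow> 'a \<Rightarrow> real"
  assumes [measurable]: "\<And>n. f n \<in> borel_measurable M"
  shows "Measurable.pred M (\<lambda>x. (\<lambda>n. f n x) \<longlonglongrightarrow> L)"
proof -
  have "(\<lambda>n. f n x) \<longlonglongrightarrow> L \<longleftrightarrow> (\<forall>j. \<exists>N. \<forall>n\<ge>N. \<bar>f n x - L\<bar> < 1 / Suc j)" for x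
  proof
    assume *: "\<forall>j. \<exists>N. \<forall>n\<ge>N. \<bar>f n x - L\<bar> < 1 / Suc j"
    show "(\<lambda>n. f n x) \<longlonglongrightarrow> L"
    proof (rule LIMSEQ_I)
      fix e :: real assume "0 < e"
      then obtain j where "1 / Suc j < e" using nat_approx_posE by blast
      then show "\<exists>N. \<forall>n\<ge>N. norm (f n x - L) < e" using *[rule_format, of j] by fastforce
    qed
  qed (auto simp: lim_sequentially dist_real_def)
  then show ?thesis by simp
qed

section \<open>Cylinder probabilities of the chain and of the stationary run\<close>

definition chain_cylinder_prob :: "('s \<Rightarrow> 's pmf) \<Rightarrow> nat \<Rightarrow> (nat \<Rightarrow> 's) \<Rightarrow> real" where
  "chain_cylinder_prob K t s = (\<Prod>k<t. pmf (K (s k)) (s (Suc k)))"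

lemma markov_chain_cylinder:
  assumes "markov_chain M K x"
  shows "measure M {\<omega> \<in> space M. \<forall>i<Suc t. x i \<omega> = s i} =
    measure M {\<omega> \<in> space M. x 0 \<omega> = s 0} * chain_cylinder_prob K t s"
proof (induction t)
  case 0
  show ?case by (simp add: chain_cylinder_prob_def)
next
  case (Suc t)
  interpret prob_space M using assms by (simp add: markov_chain_def)
  have [measurable]: "x i \<in> M \<rightarrow>\<^sub>M count_space UNIV" for i
    using assms by (simp add: markov_chain_def)
  have less: "(\<forall>i<Suc t. P i) \<longleftrightarrow> (\<forall>i\<le>t. P i)" for P :: "nat \<Rightarrow> bool" and t
    by (simp add: less_Suc_eq_le)
  have split: "(\<forall>i\<le>Suc t. x i \<omega> = s i) \<longleftrightarrow> x (Suc t) \<omega> = s (Suc t) \<and> (\<forall>i\<le>t. x i \<omega> = s i)" for \<omega>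
    by (auto simp: le_Suc_eq)
  show ?case
  proof (cases "\<P>(\<omega> in M. \<forall>i\<le>t. x i \<omega> = s i) = 0")
    \<comment> \<open>For a null history the chain condition says nothing, but then both sides are
      0.\<close>
    case True
    have "\<P>(\<omega> in M. \<forall>i\<le>Suc t. x i \<omega> = s i) \<le> \<P>(\<omega> in M. \<forall>i\<le>t. x i \<omega> = s i)"
      by (intro finite_measure_mono) auto
    then show ?thesis using True Suc
      by (auto simp: less chain_cylinder_prob_def measure_le_0_iff)
  next
    case False
    then have "\<P>(\<omega> in M. \<forall>i\<le>Suc t. x i \<omega> = s i) / \<P>(\<omega> in M. \<forall>i\<le>t. x i \<omega> = s i) = pmf (K (s t)) (s (Suc t))"
      using assms unfolding markov_chain_def cond_prob_def split by blast
    then show ?thesis using False Suc by (simp add: less chain_cylinder_prob_def field_simps)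
  qed
qed

context td_invariant_law
begin

definition visited :: "nat \<Rightarrow> ('s \<times> 's \<times> (real ^ 'n)) \<times> ('s \<Rightarrow> 's) stream \<Rightarrow> 's" where
  "visited t p = fst (fst ((advance ^^ t) p))"

definition trajectory :: "('s \<times> 's \<times> (real ^ 'n)) \<times> ('s \<Rightarrow> 's) stream \<Rightarrow> 's stream" where
  "trajectory p = to_stream (\<lambda>t. visited t p)"

lemma snth_trajectory: "trajectory p !! t = visited t p"
  by (simp add: trajectory_def to_stream_def)

lemma measurable_visited [measurable]: "visited t \<in> runs \<rightarrow>\<^sub>M count_space UNIV"
proof -
  have "(\<lambda>p. fst p) \<in> runs \<rightarrow>\<^sub>M \<nu>" unfolding runs_def by measurable
  then have "(\<lambda>p. fst (fst p)) \<in> runs \<rightarrow>\<^sub>M count_space UNIV"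
    by (rule measurable_compose) measurable
  then show ?thesis
    unfolding visited_def[abs_def] by (rule measurable_compose[OF measurable_funpow_T])
qed

lemma measurable_trajectory [measurable]: "trajectory \<in> runs \<rightarrow>\<^sub>M stream_space (count_space UNIV)"
  by (rule measurable_stream_space2) (simp add: snth_trajectory)

lemma advance_eq: "advance ((i, j, z), \<omega>) = ((j, shd \<omega> j, \<beta> *\<^sub>R z + \<phi> j), stl \<omega>)"
  unfolding advance_def by (simp add: td_step_def)

text \<open>The stationary run starts with a trace drawn from \<nu>, while \<open>trace_vec\<close>
  starts with \<phi> at the first state. Both follow the same affine recursion, so their difference
  is scaled by \<beta> at each step.\<close>

lemma run_state:
  "fst ((advance ^^ t) p) = (visited t p, visited (Suc t) p,
     trace_vec \<gamma> lam \<phi> (\<lambda>t. visited t p) t + \<beta> ^ t *\<^sub>R (snd (snd (fst p)) - \<phi> (fst (fst p))))"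
proof (induction t)
  case 0
  show ?case
    by (cases p) (auto simp: visited_def advance_eq)
next
  case (Suc t)
  obtain i j z \<omega> where p: "(advance ^^ t) p = ((i, j, z), \<omega>)" by (metis surj_pair)
  have "visited t p = i" "visited (Suc t) p = j" "visited (Suc (Suc t)) p = shd \<omega> j"
    by (simp_all add: visited_def p advance_eq)
  then show ?case using Suc
    by (simp add: p advance_eq scaleR_right_distrib flip: \<beta>_def)
qed

lemma visited_0: "visited 0 (X, \<omega>) = fst X"
  by (simp add: visited_def)

lemma visited_Suc: "visited (Suc t) (X, \<xi> ## \<omega>) = visited t (td_step \<beta> \<phi> (X, \<xi>), \<omega>)"
  by (simp add: visited_def funpow_Suc_right advance_def del: funpow.simps)

lemma space_noise: "space (stream_space (successors K)) = UNIV"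
  by (simp add: space_stream_space space_PiM)

lemma sets_visited: "{\<omega>. \<forall>i<n. visited i (X, \<omega>) = s i} \<in> sets (stream_space (successors K))"
proof -
  have "(\<lambda>\<omega>. (X, \<omega>)) \<in> stream_space (successors K) \<rightarrow>\<^sub>M runs"
    unfolding runs_def by (rule measurable_Pair1') (simp add: space_nu)
  then have [measurable]: "(\<lambda>\<omega>. visited i (X, \<omega>)) \<in> stream_space (successors K) \<rightarrow>\<^sub>M count_space UNIV" for i
    by (rule measurable_compose) measurable
  have "{\<omega> \<in> space (stream_space (successors K)). \<forall>i<n. visited i (X, \<omega>) = s i} \<in> sets (stream_space (successors K))"
    by measurable
  then show ?thesis by (simp add: space_noise)
qed

text \<open>\<open>X\<close> already contains two states, so only the later ones depend on the noise
  and the transition factors start at \<open>s 1\<close>. The induction consumes one noise letter at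
  a time and therefore needs arbitrary \<open>X\<close> and \<open>s\<close>.\<close>

lemma emeasure_visited_from:
  "emeasure (stream_space (successors K)) {\<omega>. \<forall>i<Suc (Suc t). visited i (X, \<omega>) = s i} =
     indicator {(s 0, s 1)} (fst X, fst (snd X)) * ennreal (chain_cylinder_prob K t (\<lambda>k. s (Suc k)))"
proof (induction t arbitrary: X s)
  case 0
  have "visited (Suc 0) (X, \<omega>) = fst (snd X)" for \<omega>
    by (cases X) (simp add: visited_def advance_eq)
  then have "{\<omega>. \<forall>i<Suc (Suc 0). visited i (X, \<omega>) = s i} =
      (if (fst X, fst (snd X)) = (s 0, s 1) then space (stream_space (successors K)) else {})"
    by (auto simp: less_Suc_eq visited_0 space_noise)
  then show ?case
    by (simp add: chain_cylinder_prob_def noise_stream.emeasure_space_1)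
next
  case (Suc t)
  let ?S = "stream_space (successors K)"
  obtain i j z where X: "X = (i, j, z)" by (cases X)
  have "emeasure ?S {\<omega>. \<forall>i<Suc (Suc (Suc t)). visited i (X, \<omega>) = s i}
      = (\<integral>\<^sup>+ \<xi>. emeasure ?S {\<omega>. \<forall>i<Suc (Suc (Suc t)). visited i (X, \<xi> ## \<omega>) = s i} \<partial>successors K)"
    by (subst noise.emeasure_stream_space[OF sets_visited]) (simp add: space_noise)
  also have "\<dots> = (\<integral>\<^sup>+ \<xi>. (indicator {(s 0, s 1)} (i, j) * ennreal (chain_cylinder_prob K t (\<lambda>k. s (Suc (Suc k)))))
      * indicator {s 2} (\<xi> j) \<partial>successors K)"
  proof (intro nn_integral_cong)
    fix \<xi>
    have "{\<omega>. \<forall>i<Suc (Suc (Suc t)). visited i (X, \<xi> ## \<omega>) = s i} =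
        (if i = s 0 then {\<omega>. \<forall>i<Suc (Suc t). visited i (td_step \<beta> \<phi> (X, \<xi>), \<omega>) = s (Suc i)} else {})"
      by (subst All_less_Suc2) (auto simp: visited_Suc visited_0 X)
    then show "emeasure ?S {\<omega>. \<forall>i<Suc (Suc (Suc t)). visited i (X, \<xi> ## \<omega>) = s i} =
        (indicator {(s 0, s 1)} (i, j) * ennreal (chain_cylinder_prob K t (\<lambda>k. s (Suc (Suc k)))))
      * indicator {s 2} (\<xi> j)"
      by (simp add: Suc.IH X td_step_def indicator_def numeral_2_eq_2)
  qed
  also have "\<dots> = (indicator {(s 0, s 1)} (i, j) * ennreal (chain_cylinder_prob K t (\<lambda>k. s (Suc (Suc k)))))
      * (\<integral>\<^sup>+ \<xi>. indicator {s 2} (\<xi> j) \<partial>successors K)"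
    by (rule nn_integral_cmult) (rule measurable_compose[OF measurable_successor], simp)
  also have "(\<integral>\<^sup>+ \<xi>. indicator {s 2} (\<xi> j) \<partial>successors K) = ennreal (pmf (K j) (s 2))"
    using nn_integral_distr[of "\<lambda>\<xi>. \<xi> j" "successors K" "measure_pmf (K j)" "indicator {s 2}"]
    by (simp add: distr_successor emeasure_pmf_single)
  finally show ?case
    by (auto simp: X indicator_def chain_cylinder_prob_def prod.lessThan_Suc_shift numeral_2_eq_2
        ennreal_mult' mult.commute simp del: prod.lessThan_Suc)
qed

text \<open>Integrating the formula for a fixed initial \<open>X\<close> over \<nu> supplies the
  missing first factor, the \<nu>-probability of the transition from \<open>s 0\<close> to
  \<open>s 1\<close>. A single state is handled by the marginal of \<nu>.\<close>

lemma emeasure_visited: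
  "emeasure runs {p \<in> space runs. \<forall>i<Suc t. visited i p = s i} = ennreal (pmf \<pi> (s 0) * chain_cylinder_prob K t s)"
proof (cases t)
  case 0
  have "{p \<in> space runs. \<forall>i<Suc 0. visited i p = s i} = fst -` {X. fst X = s 0} \<inter> space runs"
    by (auto simp: visited_def)
  moreover have "{X \<in> space \<nu>. fst X = s 0} \<in> sets \<nu>" by measurable
  then have "emeasure runs (fst -` {X. fst X = s 0} \<inter> space runs) = emeasure (distr runs \<nu> fst) {X. fst X = s 0}"
    by (subst emeasure_distr) (simp_all add: space_nu runs_def)
  moreover have "\<dots> = emeasure (distr \<nu> (count_space UNIV) fst) {s 0}"
    by (subst (2) emeasure_distr) (simp_all add: distr_runs_fst space_nu vimage_def)
  ultimately show ?thesis
    by (simp add: 0 distr_state emeasure_pmf_single chain_cylinder_prob_def)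
next
  case (Suc t')
  let ?A = "{p \<in> space runs. \<forall>i<Suc t. visited i p = s i}"
  have "?A \<in> sets runs" by measurable
  then have "emeasure runs ?A = (\<integral>\<^sup>+ X. emeasure (stream_space (successors K)) (Pair X -` ?A) \<partial>\<nu>)"
    unfolding runs_def by (rule noise_stream.emeasure_pair_measure_alt)
  also have "\<dots> = (\<integral>\<^sup>+ X. ennreal (chain_cylinder_prob K t' (\<lambda>k. s (Suc k))) *
      indicator {X. fst X = s 0 \<and> fst (snd X) = s 1} X \<partial>\<nu>)"
  proof (intro nn_integral_cong)
    fix X
    have "Pair X -` ?A = {\<omega>. \<forall>i<Suc (Suc t'). visited i (X, \<omega>) = s i}"
      by (auto simp: Suc runs_def space_pair_measure space_nu space_noise)
    then show "emeasure (stream_space (successors K)) (Pair X -` ?A) = ennreal (chain_cylinder_prob K t' (\<lambda>k. s (Suc k))) *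
      indicator {X. fst X = s 0 \<and> fst (snd X) = s 1} X"
      by (simp add: emeasure_visited_from indicator_def del: All_less_Suc)
  qed
  also have "\<dots> = ennreal (chain_cylinder_prob K t' (\<lambda>k. s (Suc k))) * emeasure \<nu> {X. fst X = s 0 \<and> fst (snd X) = s 1}"
  proof (rule nn_integral_cmult_indicator)
    have "{X \<in> space \<nu>. fst X = s 0 \<and> fst (snd X) = s 1} \<in> sets \<nu>" by measurable
    then show "{X. fst X = s 0 \<and> fst (snd X) = s 1} \<in> sets \<nu>" by (simp add: space_nu)
  qed
  also have "\<dots> = ennreal (pmf \<pi> (s 0) * chain_cylinder_prob K t s)"
    by (simp add: emeasure_nu_transition Suc chain_cylinder_prob_def prod.lessThan_Suc_shift
        ennreal_mult'[symmetric] prod_nonneg ac_simps del: prod.lessThan_Suc)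
  finally show ?thesis .
qed

text \<open>If \<open>x 0\<close> has law \<open>q\<close>, then the law of \<open>x\<close> has density \<open>q / \<pi>\<close>, evaluated at the first state,
  with respect to the law of the stationary trajectory: both agree on cylinder sets.\<close>

lemma AE_trajectory_transfer:
  assumes chain: "markov_chain M K x" and pi_pos: "\<And>i. pmf \<pi> i > 0"
    and Q [measurable]: "Measurable.pred (stream_space (count_space UNIV)) Q"
    and ae: "AE p in runs. Q (trajectory p)"
  shows "AE \<omega> in M. Q (to_stream (\<lambda>t. x t \<omega>))"
proof -
  interpret M: prob_space M using chain by (simp add: markov_chain_def)
  have [measurable]: "x i \<in> M \<rightarrow>\<^sub>M count_space UNIV" for i
    using chain by (simp add: markov_chain_def)
  let ?SS = "stream_space (count_space UNIV) :: 's stream measure"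
  define X where "X \<omega> = to_stream (\<lambda>t. x t \<omega>)" for \<omega>
  have X_nth: "X \<omega> !! t = x t \<omega>" for \<omega> t by (simp add: X_def to_stream_def)
  have X [measurable]: "X \<in> M \<rightarrow>\<^sub>M ?SS"
    by (rule measurable_stream_space2) (simp add: X_nth)
  have "prob_space (distr M (count_space UNIV) (x 0))"
    by (rule M.prob_space_distr) measurable
  then obtain q where q: "measure_pmf q = distr M (count_space UNIV) (x 0)"
    by (rule prob_space_eq_measure_pmf) auto
  define \<Lambda> where "\<Lambda> = distr runs ?SS trajectory"
  define w where "w s = ennreal (pmf q (shd s) / pmf \<pi> (shd s))" for s
  have w [measurable]: "w \<in> borel_measurable ?SS"
    unfolding w_def by measurable
  have \<Lambda>_sets [measurable_cong]: "sets \<Lambda> = sets ?SS" by (simp add: \<Lambda>_def)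
  have law: "distr M ?SS X = density \<Lambda> w"
  proof (rule stream_space_eq_sstart[of UNIV])
    show "prob_space (distr M ?SS X)" by (rule M.prob_space_distr) measurable
    show "prob_space (density \<Lambda> w)"
    proof
      have "emeasure (density \<Lambda> w) (space (density \<Lambda> w)) = (\<integral>\<^sup>+ s. w s \<partial>\<Lambda>)"
        by (simp add: emeasure_density cong: nn_integral_cong)
      also have "\<dots> = (\<integral>\<^sup>+ p. ennreal (pmf q (fst (fst p)) / pmf \<pi> (fst (fst p))) \<partial>runs)"
        unfolding \<Lambda>_def by (subst nn_integral_distr)
          (simp_all add: w_def snth.simps(1)[symmetric] snth_trajectory visited_def del: snth.simps)
      also have "\<dots> = (\<integral>\<^sup>+ X. ennreal (pmf q (fst X) / pmf \<pi> (fst X)) \<partial>distr runs \<nu> fst)"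
        by (rule nn_integral_distr[symmetric]) (simp_all add: runs_def)
      also have "\<dots> = (\<integral>\<^sup>+ a. ennreal (pmf q a / pmf \<pi> a) \<partial>distr \<nu> (count_space UNIV) fst)"
        unfolding distr_runs_fst by (rule nn_integral_distr[symmetric]) simp_all
      \<comment> \<open>Since \<pi> charges every state, the quotient cancels and the \<pi>-mean of
        q / \<pi> is the total mass of \<open>q\<close>.\<close>
      also have "\<dots> = (\<integral>\<^sup>+ a. ennreal (pmf q a) \<partial>count_space UNIV)"
        unfolding distr_state nn_integral_measure_pmf
        using pi_pos by (intro nn_integral_cong) (simp add: ennreal_mult'[symmetric] less_imp_neq[symmetric])
      also have "\<dots> = 1" by (simp add: nn_integral_pmf)
      finally show "emeasure (density \<Lambda> w) (space (density \<Lambda> w)) = 1" .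
    qed
    fix xs :: "'s list" assume "xs \<noteq> []"
    then obtain t where t: "length xs = Suc t" by (cases xs) auto
    have mem: "s \<in> sstart UNIV xs \<longleftrightarrow> (\<forall>i<Suc t. s !! i = xs ! i)" for s
      by (simp add: sstart_eq t)
    have "emeasure (distr M ?SS X) (sstart UNIV xs) = emeasure M {\<omega> \<in> space M. \<forall>i<Suc t. x i \<omega> = xs ! i}"
      by (subst emeasure_distr) (auto simp: mem X_nth intro!: arg_cong[where f = "emeasure M"])
    also have "\<dots> = ennreal (measure M {\<omega> \<in> space M. x 0 \<omega> = xs ! 0} * chain_cylinder_prob K t ((!) xs))"
      unfolding M.emeasure_eq_measure markov_chain_cylinder[OF chain] ..
    also have "measure M {\<omega> \<in> space M. x 0 \<omega> = xs ! 0} = pmf q (xs ! 0)"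
      by (simp add: pmf.rep_eq q measure_distr vimage_def Int_def conj_commute)
    finally have 1: "emeasure (distr M ?SS X) (sstart UNIV xs)
      = ennreal (pmf q (xs ! 0) * chain_cylinder_prob K t ((!) xs))" .
    have "emeasure (density \<Lambda> w) (sstart UNIV xs) = (\<integral>\<^sup>+ s. w s * indicator (sstart UNIV xs) s \<partial>\<Lambda>)"
      by (simp add: emeasure_density)
    also have "\<dots> = (\<integral>\<^sup>+ s. ennreal (pmf q (xs ! 0) / pmf \<pi> (xs ! 0)) * indicator (sstart UNIV xs) s \<partial>\<Lambda>)"
    proof (intro nn_integral_cong)
      fix s
      have "shd s = xs ! 0" if "s \<in> sstart UNIV xs"
        using that[unfolded mem, rule_format, of 0] by simp
      then show "w s * indicator (sstart UNIV xs) s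
          = ennreal (pmf q (xs ! 0) / pmf \<pi> (xs ! 0)) * indicator (sstart UNIV xs) s"
        by (simp add: w_def indicator_def)
    qed
    also have "\<dots> = ennreal (pmf q (xs ! 0) / pmf \<pi> (xs ! 0)) * emeasure \<Lambda> (sstart UNIV xs)"
      by (rule nn_integral_cmult_indicator) simp
    also have "emeasure \<Lambda> (sstart UNIV xs) = emeasure runs {p \<in> space runs. \<forall>i<Suc t. visited i p = xs ! i}"
      unfolding \<Lambda>_def
      by (subst emeasure_distr) (auto simp: mem snth_trajectory intro!: arg_cong[where f = "emeasure runs"])
    also have "\<dots> = ennreal (pmf \<pi> (xs ! 0) * chain_cylinder_prob K t ((!) xs))"
      by (rule emeasure_visited)
    also have "ennreal (pmf q (xs ! 0) / pmf \<pi> (xs ! 0)) * \<dots>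
        = ennreal (pmf q (xs ! 0) * chain_cylinder_prob K t ((!) xs))"
      using pi_pos[of "xs ! 0"] by (simp add: ennreal_mult'[symmetric])
    finally show "emeasure (distr M ?SS X) (sstart UNIV xs) = emeasure (density \<Lambda> w) (sstart UNIV xs)"
      using 1 by simp
  qed (simp_all add: \<Lambda>_sets)
  have "AE s in \<Lambda>. Q s"
    unfolding \<Lambda>_def using ae by (subst AE_distr_iff) (simp_all add: pred_def)
  then have "AE s in density \<Lambda> w. Q s"
    by (subst AE_density) auto
  then have "AE s in distr M ?SS X. Q s" unfolding law .
  then show ?thesis unfolding X_def[symmetric]
    by (rule AE_distrD[OF X])
qed

section \<open>The strong law along trajectories\<close>

lemma AE_trajectory_average:
  assumes L2: "integrable (measure_pmf (transition_law K \<pi>)) (\<lambda>p. (\<psi> (fst p) (snd p))\<^sup>2)"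
  shows "AE p in runs. (\<lambda>n. (\<Sum>t<n. trace_vec \<gamma> lam \<phi> (\<lambda>t. visited t p) t $ a * \<psi> (visited t p) (visited (Suc t) p)) / n)
    \<longlonglongrightarrow> (LINT X|\<nu>. snd (snd X) $ a * \<psi> (fst X) (fst (snd X)))"
proof -
  let ?\<psi> = "\<lambda>X :: 's \<times> 's \<times> (real ^ 'n). \<psi> (fst X) (fst (snd X))"
  have [measurable]: "?\<psi> \<in> borel_measurable \<nu>"
    using measurable_compose[OF measurable_transition, of "\<lambda>p. \<psi> (fst p) (snd p)"] by simp
  have \<psi>2: "integrable \<nu> (\<lambda>X. (?\<psi> X)\<^sup>2)"
    using L2 by (simp only: integrable_nu_transition[of "\<lambda>i j. (\<psi> i j)\<^sup>2"])
  have 1: "integrable \<nu> (\<lambda>X. snd (snd X) $ a * ?\<psi> X)"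
    by (rule integrable_trace_product[OF _ \<psi>2]) simp
  have 2: "integrable \<nu> ?\<psi>"
    using integrable_mult_square_integrable[of ?\<psi> \<nu> "\<lambda>_. 1"] \<psi>2 by simp
  show ?thesis
    using birkhoff_average[OF 1] birkhoff_average[OF 2]
  proof eventually_elim
    case (elim p)
    let ?c = "(snd (snd (fst p)) - \<phi> (fst (fst p))) $ a"
    let ?t = "\<lambda>t. trace_vec \<gamma> lam \<phi> (\<lambda>t. visited t p) t $ a"
      and ?u = "\<lambda>t. \<psi> (visited t p) (visited (Suc t) p)"
    have "(\<lambda>n. (\<Sum>t<n. (?t t + \<beta> ^ t * ?c) * ?u t) / n) \<longlonglongrightarrow> (LINT X|\<nu>. snd (snd X) $ a * ?\<psi> X)"
      using elim(1) unfolding run_state by simp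
    \<comment> \<open>The correction for the random initial trace is a fixed multiple of a
      discounted average of \<psi>, which vanishes because the plain averages of \<psi>
      converge.\<close>
    moreover have "(\<lambda>n. (\<Sum>t<n. \<beta> ^ t * ?u t) / n) \<longlonglongrightarrow> 0"
      using elim(2) unfolding run_state by (intro discounted_average_tendsto_0 beta) simp
    ultimately have "(\<lambda>n. (\<Sum>t<n. (?t t + \<beta> ^ t * ?c) * ?u t) / n - ?c * ((\<Sum>t<n. \<beta> ^ t * ?u t) / n))
        \<longlonglongrightarrow> (LINT X|\<nu>. snd (snd X) $ a * ?\<psi> X) - ?c * 0"
      by (intro tendsto_diff tendsto_mult tendsto_const)
    moreover have "(\<Sum>t<n. (?t t + \<beta> ^ t * ?c) * ?u t) / n - ?c * ((\<Sum>t<n. \<beta> ^ t * ?u t) / n)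
        = (\<Sum>t<n. ?t t * ?u t) / n" for n
      by (simp only: distrib_right sum.distrib add_divide_distrib)
        (simp add: sum_distrib_left ac_simps)
    ultimately show ?case by simp
  qed
qed

lemma AE_chain_average:
  assumes chain: "markov_chain M K x" and pi_pos: "\<And>i. pmf \<pi> i > 0"
    and L2: "integrable (measure_pmf (transition_law K \<pi>)) (\<lambda>p. (\<psi> (fst p) (snd p))\<^sup>2)"
  shows "AE \<omega> in M. (\<lambda>n. (\<Sum>t<n. trace_vec \<gamma> lam \<phi> (\<lambda>t. x t \<omega>) t $ a * \<psi> (x t \<omega>) (x (Suc t) \<omega>)) / n)
    \<longlonglongrightarrow> (LINT X|\<nu>. snd (snd X) $ a * \<psi> (fst X) (fst (snd X)))"
proof -
  let ?SS = "stream_space (count_space UNIV) :: 's stream measure"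
  let ?Q = "\<lambda>s. (\<lambda>n. (\<Sum>t<n. trace_vec \<gamma> lam \<phi> (\<lambda>t. s !! t) t $ a * \<psi> (s !! t) (s !! Suc t)) / n)
    \<longlonglongrightarrow> (LINT X|\<nu>. snd (snd X) $ a * \<psi> (fst X) (fst (snd X)))"
  have [measurable]: "(\<lambda>s. trace_vec \<gamma> lam \<phi> (\<lambda>t. s !! t) t) \<in> borel_measurable ?SS" for t
    by (induction t) (simp_all del: snth.simps)
  have [measurable]: "(\<lambda>s. \<psi> (s !! t) (s !! Suc t)) \<in> borel_measurable ?SS" for t
  proof -
    have "(\<lambda>s. (s !! t, s !! Suc t)) \<in> ?SS \<rightarrow>\<^sub>M count_space UNIV \<Otimes>\<^sub>M count_space UNIV"
      by (intro measurable_Pair measurable_snth)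
    then have "(\<lambda>s. (s !! t, s !! Suc t)) \<in> ?SS \<rightarrow>\<^sub>M count_space UNIV"
      by (simp add: pair_measure_countable)
    from measurable_compose[OF this, of "case_prod \<psi>" borel] show ?thesis by simp
  qed
  \<comment> \<open>\<open>trace_vec\<close> is computed from the states alone, so the event is a
    property of the state stream and passes from the stationary run to the given chain.\<close>
  have "AE \<omega> in M. ?Q (to_stream (\<lambda>t. x t \<omega>))"
  proof (rule AE_trajectory_transfer[OF chain pi_pos])
    show "Measurable.pred ?SS ?Q"
      by (intro pred_LIMSEQ borel_measurable_divide borel_measurable_sum borel_measurable_times) measurable
    show "AE p in runs. ?Q (trajectory p)"
      unfolding snth_trajectory by (rule AE_trajectory_average[OF L2])
  qed
  then show ?thesis by (simp add: to_stream_def del: snth.simps)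
qed

end

section \<open>Convergence\<close>

lemma integrable_vec:
  fixes f :: "'a \<Rightarrow> ('b :: euclidean_space) ^ 'n"
  assumes "\<And>i. integrable M (\<lambda>x. f x $ i)"
  shows "integrable M f"
proof -
  have "linear (axis i :: 'b \<Rightarrow> 'b ^ 'n)" for i
    by (intro linearI) (simp_all add: vec_eq_iff axis_def)
  then have "bounded_linear (axis i :: 'b \<Rightarrow> 'b ^ 'n)" for i
    by (simp add: linear_conv_bounded_linear)
  then have "integrable M (\<lambda>x. axis i (f x $ i))" for i
    using assms by (rule integrable_bounded_linear)
  then have "integrable M (\<lambda>x. \<Sum>i\<in>UNIV. axis i (f x $ i))" by simp
  moreover have "(\<lambda>x. \<Sum>i\<in>UNIV. axis i (f x $ i)) = f"
    by (auto simp: fun_eq_iff vec_eq_iff axis_def if_distrib cong: if_cong)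
  ultimately show ?thesis by simp
qed

lemma integral_vec_nth:
  fixes f :: "'a \<Rightarrow> ('b :: euclidean_space) ^ 'n"
  assumes "integrable M f"
  shows "(LINT x|M. f x) $ i = (LINT x|M. f x $ i)"
  by (rule integral_bounded_linear[OF bounded_linear_vec_nth assms, symmetric])

lemma invertible_if_ker_trivial:
  fixes A :: "real ^ 'n ^ 'n"
  assumes "\<And>v. A *v v = 0 \<Longrightarrow> v = 0"
  shows "invertible A"
  using assms by (auto simp: invertible_left_inverse matrix_left_invertible_ker)

lemma td_A_nth: "td_A \<gamma> \<phi> X $ a $ b = snd (snd X) $ a * feature_diff \<gamma> \<phi> (fst X) (fst (snd X)) $ b"
  by (cases X) (simp add: td_A_def outer_def)

lemma td_b_nth: "td_b r X $ a = snd (snd X) $ a * r (fst X) (fst (snd X))"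
  by (cases X) (simp add: td_b_def)

lemma td_state_sel:
  "fst (td_state \<gamma> lam \<phi> x t) = x t" "fst (snd (td_state \<gamma> lam \<phi> x t)) = x (Suc t)"
  "snd (snd (td_state \<gamma> lam \<phi> x t)) = trace_vec \<gamma> lam \<phi> x t"
  by (simp_all add: td_state_def)

text \<open>Dividing the normal equation by t makes the fixed initial terms
  \<open>mat 1 / \<delta>\<close> and \<open>w0 / \<delta>\<close> vanish, so the averaged system
  tends to the one with matrix \<open>A\<close> and solution \<open>w\<close>.\<close>

lemma rls_td_tendsto:
  fixes \<phi> :: "'s \<Rightarrow> real ^ 'n"
  assumes run: "rls_td_run 1 \<gamma> lam \<phi> r \<delta> w0 x V W" and "\<delta> \<noteq> 0"
    and A: "\<And>a b. (\<lambda>n. (\<Sum>t<n. td_A \<gamma> \<phi> (td_state \<gamma> lam \<phi> x t) $ a $ b) / n) \<longlonglongrightarrow> A $ a $ b"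
    and b: "\<And>a. (\<lambda>n. (\<Sum>t<n. td_b r (td_state \<gamma> lam \<phi> x t) $ a) / n) \<longlonglongrightarrow> (A *v w) $ a"
    and inv: "invertible A"
  shows "W \<longlonglongrightarrow> w"
proof (rule tendsto_linear_system_solution[OF _ _ inv])
  let ?R = "\<lambda>t. (1 / \<delta>) *\<^sub>R mat 1 + (\<Sum>s<t. td_A \<gamma> \<phi> (td_state \<gamma> lam \<phi> x s))"
  let ?c = "\<lambda>t. (1 / \<delta>) *\<^sub>R w0 + (\<Sum>s<t. td_b r (td_state \<gamma> lam \<phi> x s))"
  have perturb: "(\<lambda>n. (c + u n) / n) \<longlonglongrightarrow> l" if "(\<lambda>n. u n / n) \<longlonglongrightarrow> l" for c l :: real and u
  proof -
    have "(\<lambda>n. c * (1 / real n) + u n / n) \<longlonglongrightarrow> c * 0 + l"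
      by (intro tendsto_intros lim_1_over_n that)
    then show ?thesis by (simp add: add_divide_distrib)
  qed
  show "(\<lambda>t. (1 / real t) *\<^sub>R ?R t) \<longlonglongrightarrow> A"
  proof (intro vec_tendstoI)
    show "(\<lambda>t. ((1 / real t) *\<^sub>R ?R t) $ a $ b) \<longlonglongrightarrow> A $ a $ b" for a b
      using perturb[OF A, of "mat 1 $ a $ b / \<delta>" a b] by (simp add: add_divide_distrib)
  qed
  show "(\<lambda>t. (1 / real t) *\<^sub>R ?c t) \<longlonglongrightarrow> A *v w"
  proof (intro vec_tendstoI)
    show "(\<lambda>t. ((1 / real t) *\<^sub>R ?c t) $ a) \<longlonglongrightarrow> (A *v w) $ a" for a
      using perturb[OF b, of "w0 $ a / \<delta>" a] by (simp add: add_divide_distrib)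
  qed
  \<comment> \<open>The equation holds even at t = 0, where 1 / 0 = 0 makes both sides 0.\<close>
  show "\<forall>\<^sub>F t in sequentially. ((1 / real t) *\<^sub>R ?R t) *v W t = (1 / real t) *\<^sub>R ?c t"
    using rls_td_normal_equation[OF run \<open>\<delta> \<noteq> 0\<close>]
    by (simp flip: scaleR_matrix_vector_assoc)
qed

context td_invariant_law
begin

lemma integrable_td_A: "integrable \<nu> (td_A \<gamma> \<phi>)"
proof (intro integrable_vec)
  have [measurable]: "(\<lambda>X. feature_diff \<gamma> \<phi> (fst X) (fst (snd X)) $ b) \<in> borel_measurable \<nu>" for b
    using measurable_compose[OF measurable_transition, of "\<lambda>p. feature_diff \<gamma> \<phi> (fst p) (snd p) $ b"] by simp
  show "integrable \<nu> (\<lambda>X. td_A \<gamma> \<phi> X $ a $ b)" for a b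
    unfolding td_A_nth by (rule integrable_trace_product[OF _ integrable_square_feature_diff]) simp
qed

lemma integrable_td_b:
  assumes "integrable (measure_pmf (transition_law K \<pi>)) (\<lambda>p. (r (fst p) (snd p))\<^sup>2)"
  shows "integrable \<nu> (td_b r)"
proof (intro integrable_vec)
  have [measurable]: "(\<lambda>X. r (fst X) (fst (snd X))) \<in> borel_measurable \<nu>"
    using measurable_compose[OF measurable_transition, of "\<lambda>p. r (fst p) (snd p)"] by simp
  have "integrable \<nu> (\<lambda>X. (r (fst X) (fst (snd X)))\<^sup>2)"
    using assms by (simp only: integrable_nu_transition[of "\<lambda>i j. (r i j)\<^sup>2"])
  then show "integrable \<nu> (\<lambda>X. td_b r X $ a)" for a
    unfolding td_b_nth by (intro integrable_trace_product) simp_all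
qed

text \<open>The quadratic form of the mean matrix at v is E[(v \<bullet> z) (v \<bullet> d)] with d
  the feature difference. It is positive unless v \<bullet> \<phi> vanishes almost everywhere under
  \<pi>, which linear independence and the positivity of \<pi> exclude for v \<noteq> 0. So the
  kernel is trivial.\<close>

lemma invertible_mean_td_A:
  assumes "\<gamma> < 1" and pi_pos: "\<And>i. pmf \<pi> i > 0"
    and lin_indep: "\<And>c :: real ^ 'n. (\<And>s. (\<Sum>i\<in>UNIV. c $ i * \<phi> s $ i) = 0) \<Longrightarrow> c = 0"
  shows "invertible (LINT X|\<nu>. td_A \<gamma> \<phi> X)"
proof (rule invertible_if_ker_trivial, rule ccontr)
  fix v assume ker: "(LINT X|\<nu>. td_A \<gamma> \<phi> X) *v v = 0" and "v \<noteq> 0"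
  have "\<exists>s. v \<bullet> \<phi> s \<noteq> 0"
  proof (rule ccontr)
    assume "\<nexists>s. v \<bullet> \<phi> s \<noteq> 0"
    then have "(\<Sum>i\<in>UNIV. v $ i * \<phi> s $ i) = 0" for s by (simp add: inner_vec_def)
    then show False using lin_indep \<open>v \<noteq> 0\<close> by blast
  qed
  then obtain s where s: "v \<bullet> \<phi> s \<noteq> 0" by blast
  have "integrable (measure_pmf \<pi>) (\<lambda>s. (v \<bullet> \<phi> s)\<^sup>2)"
    using basis_L2 by (rule integrable_inner_square) simp
  moreover have "\<not> (AE s in measure_pmf \<pi>. (v \<bullet> \<phi> s)\<^sup>2 = 0)"
    using s pi_pos[of s] by (auto simp: AE_measure_pmf_iff set_pmf_iff)
  ultimately have "(LINT s|measure_pmf \<pi>. (v \<bullet> \<phi> s)\<^sup>2) \<noteq> 0"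
    by (subst integral_nonneg_eq_0_iff_AE) auto
  then have "0 < (LINT s|measure_pmf \<pi>. (v \<bullet> \<phi> s)\<^sup>2)" by (simp add: less_le)
  then have "0 < (LINT X|\<nu>. (v \<bullet> snd (snd X)) * (v \<bullet> feature_diff \<gamma> \<phi> (fst X) (fst (snd X))))"
    by (rule quadratic_form_pos[OF \<open>\<gamma> < 1\<close>])
  also have "\<dots> = (LINT X|\<nu>. v \<bullet> (td_A \<gamma> \<phi> X *v v))"
  proof (intro Bochner_Integration.integral_cong refl)
    show "(v \<bullet> snd (snd X)) * (v \<bullet> feature_diff \<gamma> \<phi> (fst X) (fst (snd X))) = v \<bullet> (td_A \<gamma> \<phi> X *v v)" for X
      by (cases X) (simp add: td_A_def outer_mult_vec inner_commute[of v])
  qed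
  also have "\<dots> = v \<bullet> ((LINT X|\<nu>. td_A \<gamma> \<phi> X) *v v)"
  proof (rule integral_bounded_linear[OF _ integrable_td_A])
    have "linear (\<lambda>A :: real ^ 'n ^ 'n. v \<bullet> (A *v v))"
      by (intro linearI) (simp_all add: matrix_vector_mult_add_rdistrib inner_add_right
          flip: scaleR_matrix_vector_assoc)
    then show "bounded_linear (\<lambda>A :: real ^ 'n ^ 'n. v \<bullet> (A *v v))"
      by (simp add: linear_conv_bounded_linear)
  qed
  finally show False using ker by simp
qed

end

theorem theorem1:
  fixes M :: "'w measure"
    and x :: "nat \<Rightarrow> 'w \<Rightarrow> 's::countable"
    and K :: "'s \<Rightarrow> 's pmf" and \<pi> :: "'s pmf"
    and r :: "'s \<Rightarrow> 's \<Rightarrow> real"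
    and \<phi> :: "'s \<Rightarrow> real ^ 'n"
    and \<gamma> lam \<delta> :: real and w0 :: "real ^ 'n"
    and V :: "nat \<Rightarrow> 'w \<Rightarrow> real ^ 'n ^ 'n" and W :: "nat \<Rightarrow> 'w \<Rightarrow> real ^ 'n"
    and \<nu> :: "('s \<times> 's \<times> (real ^ 'n)) measure"
  assumes chain: "markov_chain M K x"
    and gamma: "0 < \<gamma>" "\<gamma> \<le> 1" and lambda: "0 \<le> lam" "lam \<le> 1" and delta: "0 < \<delta>"
    and run: "AE \<omega> in M. rls_td_run 1 \<gamma> lam \<phi> r \<delta> w0 (\<lambda>t. x t \<omega>) (\<lambda>t. V t \<omega>) (\<lambda>t. W t \<omega>)"
    and ergodic: "ergodic_chain K"
    and pi_stationary: "stationary K \<pi>"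
    and pi_unique: "\<And>\<pi>'. stationary K \<pi>' \<Longrightarrow> \<pi>' = \<pi>"
    and pi_pos: "\<And>i. pmf \<pi> i > 0"
    and reward_L2: "integrable (measure_pmf (transition_law K \<pi>)) (\<lambda>(i, j). (r i j)\<^sup>2)"
    and lin_indep: "\<And>c :: real ^ 'n. (\<And>s. (\<Sum>i\<in>UNIV. c $ i * \<phi> s $ i) = 0) \<Longrightarrow> c = 0"
    and basis_L2: "\<And>i. integrable (measure_pmf \<pi>) (\<lambda>s. (\<phi> s $ i)\<^sup>2)"
    and nonsingular: "AE \<omega> in M. \<forall>T::nat. T > 0 \<longrightarrow>
          invertible (matrix_inv (\<delta> *\<^sub>R mat 1) +
            (1 / real T) *\<^sub>R (\<Sum>t=1..T. td_A \<gamma> \<phi> (td_state \<gamma> lam \<phi> (\<lambda>t. x t \<omega>) t)))"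
    and nu_invariant: "td_invariant K \<gamma> lam \<phi> \<nu>"
    and nu_unique: "\<And>\<nu>'. td_invariant K \<gamma> lam \<phi> \<nu>' \<Longrightarrow> \<nu>' = \<nu>"
    and undiscounted: "\<gamma> = 1 \<Longrightarrow> \<exists>!w. td_equation \<gamma> \<phi> r \<nu> w"
  shows "\<exists>Wstar. (\<forall>w. td_equation \<gamma> \<phi> r \<nu> w \<longleftrightarrow> w = Wstar) \<and>
           (AE \<omega> in M. (\<lambda>t. W t \<omega>) \<longlonglongrightarrow> Wstar)"
proof -
  interpret td_invariant_law K \<pi> \<gamma> lam \<phi> \<nu>
    by (rule td_invariant_law.intro) (fact gamma lambda pi_unique basis_L2 nu_invariant nu_unique)+
  have reward: "integrable (measure_pmf (transition_law K \<pi>)) (\<lambda>p. (r (fst p) (snd p))\<^sup>2)"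
    using reward_L2 by (simp add: case_prod_unfold)
  define A where "A = (LINT X|\<nu>. td_A \<gamma> \<phi> X)"
  define b where "b = (LINT X|\<nu>. td_b r X)"
  have eq: "td_equation \<gamma> \<phi> r \<nu> w \<longleftrightarrow> A *v w = b" for w
    by (simp add: td_equation_def A_def b_def)
  \<comment> \<open>For \<gamma> = 1 the quadratic form can vanish. There a nonzero kernel vector is
    ruled out because adding it to the solution of the equation would give a second one.\<close>
  have inv: "invertible A"
  proof (cases "\<gamma> = 1")
    case True
    obtain w where w: "A *v w = b" and "\<forall>w'. A *v w' = b \<longrightarrow> w' = w"
      using undiscounted[OF True] unfolding eq by (rule ex1E)
    then have unique: "A *v w' = b \<Longrightarrow> w' = w" for w' by blast
    show ?thesis
    proof (rule invertible_if_ker_trivial)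
      fix v assume "A *v v = 0"
      then show "v = 0" using w unique[of "w + v"] by (simp add: matrix_vector_right_distrib)
    qed
  next
    case False
    then have "\<gamma> < 1" using gamma by simp
    then show ?thesis
      unfolding A_def by (rule invertible_mean_td_A[OF _ pi_pos lin_indep])
  qed
  obtain B where B: "A ** B = mat 1" "B ** A = mat 1"
    using inv by (auto simp: invertible_def)
  define w where "w = B *v b"
  have Aw: "A *v w = b" by (simp add: w_def matrix_vector_mul_assoc B)
  have "w' = w" if "A *v w' = b" for w'
    by (simp add: w_def that[symmetric] matrix_vector_mul_assoc B)
  then have w: "A *v w' = b \<longleftrightarrow> w' = w" for w' using Aw by blast
  have "AE \<omega> in M. \<forall>a\<in>UNIV. \<forall>c\<in>UNIV.
      (\<lambda>n. (\<Sum>t<n. td_A \<gamma> \<phi> (td_state \<gamma> lam \<phi> (\<lambda>t. x t \<omega>) t) $ a $ c) / n) \<longlonglongrightarrow> A $ a $ c"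
  proof (intro AE_finite_allI finite)
    fix a c
    have "integrable (measure_pmf (transition_law K \<pi>)) (\<lambda>p. (feature_diff \<gamma> \<phi> (fst p) (snd p) $ c)\<^sup>2)"
      using integrable_square_feature_diff[of c]
      by (simp only: integrable_nu_transition[of "\<lambda>i j. (feature_diff \<gamma> \<phi> i j $ c)\<^sup>2"])
    from AE_chain_average[OF chain pi_pos this, of a]
    show "AE \<omega> in M. (\<lambda>n. (\<Sum>t<n. td_A \<gamma> \<phi> (td_state \<gamma> lam \<phi> (\<lambda>t. x t \<omega>) t) $ a $ c) / n) \<longlonglongrightarrow> A $ a $ c"
      using integral_vec_nth[OF integrable_td_A, of a]
        integral_vec_nth[OF integrable_bounded_linear[OF bounded_linear_vec_nth[of a] integrable_td_A], of c]
      by (simp add: A_def td_A_nth td_state_sel)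
  qed
  moreover have "AE \<omega> in M. \<forall>a\<in>UNIV.
      (\<lambda>n. (\<Sum>t<n. td_b r (td_state \<gamma> lam \<phi> (\<lambda>t. x t \<omega>) t) $ a) / n) \<longlonglongrightarrow> b $ a"
  proof (intro AE_finite_allI finite)
    fix a
    show "AE \<omega> in M. (\<lambda>n. (\<Sum>t<n. td_b r (td_state \<gamma> lam \<phi> (\<lambda>t. x t \<omega>) t) $ a) / n) \<longlonglongrightarrow> b $ a"
      using AE_chain_average[OF chain pi_pos reward, of a] integral_vec_nth[OF integrable_td_b[OF reward], of a]
      by (simp add: b_def td_b_nth td_state_sel)
  qed
  ultimately have "AE \<omega> in M. (\<lambda>t. W t \<omega>) \<longlonglongrightarrow> w"
    using run
  proof eventually_elim
    case (elim \<omega>)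
    show ?case
    proof (rule rls_td_tendsto[OF elim(3) _ _ _ inv])
      show "\<delta> \<noteq> 0" using delta by simp
    qed (use elim(1,2) Aw in simp_all)
  qed
  then show ?thesis unfolding eq w by blast
qed

end
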